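(* Let $k\ge 2$ be an integer. (1) If $C_k^{>++}\neq\emptyset$, then there exist $\nu_k^{>}\ge\lambda_1^m$, $\mu_k^{>}\ge\lambda_1^n$ and a strictly decreasing $C^1$ function $f_k^{>}$ from $]\nu_k^{>},+\infty[$ onto $]\mu_k^{>},+\infty[$, with $(f_k^{>})'(x)<0$ for all $x\in]\nu_k^{>},+\infty[$, such that $$C_k^{>++}=\{(x,f_k^{>}(x)) : x\in]\nu_k^{>},+\infty[\}.$$ (2) If $C_k^{<++}\neq\emptyset$, then similarly there exist $\nu_k^{<}\ge\lambda_1^m$, $\mu_k^{<}\ge\lambda_1^n$ and a strictly decreasing $C^1$ function $f_k^{<}$ from $]\nu_k^{<},+\infty[$ onto $]\mu_k^{<},+\infty[$, with $(f_k^{<})'(x)<0$ for all $x\in]\nu_k^{<},+\infty[$, such that $$C_k^{<++}=\{(x,f_k^{<}(x)) : x\in]\nu_k^{<},+\infty[\}.$$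
   Context: Let $T_1<T_2$ be reals and let $p,q,m,n\in C[T_1,T_2]$ be real-valued with $p>0$, $q\ge 0$ on $[T_1,T_2]$, $m\not\equiv 0$, $n\not\equiv 0$. Put $Lu:=-(p(t)u')'+q(t)u$ and $u^{\pm}:=\max\{\pm u,0\}$. For $(a,b)\in\mathbb{R}^2$ consider the problem $$(P)\qquad Lu=a\,m(t)u^{+}-b\,n(t)u^{-}\ \text{in } ]T_1,T_2[,\qquad u(T_1)=u(T_2)=0,$$ solutions being functions $u\in C^1[T_1,T_2]$ with $pu'\in C^1[T_1,T_2]$. For $k\ge 1$, $C_k^{>}$ (resp. $C_k^{<}$) is the set of $(a,b)\in\mathbb{R}^2$ such that $(P)$ has a solution $u$ with exactly $k-1$ zeros in $]T_1,T_2[$ and $u'(T_1)>0$ (resp. $u'(T_1)<0$). With $\mathbb{R}^{+}=]0,+\infty[$, put $C_k^{>++}:=C_k^{>}\cap(\mathbb{R}^{+}\times\mathbb{R}^{+})$ and $C_k^{<++}:=C_k^{<}\cap(\mathbb{R}^{+}\times\mathbb{R}^{+})$. $\lambda_1^m$ (resp. $\lambda_1^n$) denotes the smallest positive eigenvalue $\lambda$ of $Lu=\lambda m(t)u$ (resp. $Lu=\lambda n(t)u$) in $]T_1,T_2[$, $u(T_1)=u(T_2)=0$; it exists exactly when $m$ (resp. $n$) is positive somewhere in $]T_1,T_2[$, which is automatically the case when $C_k^{>++}$ or $C_k^{<++}$ is nonempty for some $k\ge2$. *)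

theory Defs
  imports "HOL-Analysis.Analysis"
begin

text \<open>
  Functions on \<open>[T1, T2]\<close> are total functions of type \<open>real \<Rightarrow> real\<close> whose values outside the
  interval are irrelevant. Derivatives are therefore taken within \<open>{T1..T2}\<close>: they are one-sided
  at the endpoints and ordinary derivatives at interior points.
\<close>

definition D :: "real \<Rightarrow> real \<Rightarrow> (real \<Rightarrow> real) \<Rightarrow> real \<Rightarrow> real" where
  "D T1 T2 u t = vector_derivative u (at t within {T1..T2})"

text \<open>
  The library's \<open>C1_differentiable_on\<close> asks for two-sided derivatives, so it would also constrain
  the function outside a closed interval.
\<close>

definition C1_Icc :: "real \<Rightarrow> real \<Rightarrow> (real \<Rightarrow> real) \<Rightarrow> bool" where
  "C1_Icc T1 T2 u \<longleftrightarrow> u differentiable_on {T1..T2} \<and> continuous_on {T1..T2} (D T1 T2 u)"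

definition L ::
  "real \<Rightarrow> real \<Rightarrow> (real \<Rightarrow> real) \<Rightarrow> (real \<Rightarrow> real) \<Rightarrow> (real \<Rightarrow> real) \<Rightarrow> real \<Rightarrow> real" where
  "L T1 T2 p q u t = - D T1 T2 (\<lambda>s. p s * D T1 T2 u s) t + q t * u t"

definition pos_part :: "(real \<Rightarrow> real) \<Rightarrow> real \<Rightarrow> real" where
  "pos_part u t = max (u t) 0"

definition neg_part :: "(real \<Rightarrow> real) \<Rightarrow> real \<Rightarrow> real" where
  "neg_part u t = max (- u t) 0"

definition dirichlet_solution ::
  "real \<Rightarrow> real \<Rightarrow> (real \<Rightarrow> real) \<Rightarrow> (real \<Rightarrow> real) \<Rightarrow> (real \<Rightarrow> real) \<Rightarrow> (real \<Rightarrow> real) \<Rightarrow> bool" where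
  \<comment> \<open>\<open>u\<close> solves \<open>L u = g\<close> in the open interval with zero boundary values\<close>
  "dirichlet_solution T1 T2 p q g u \<longleftrightarrow>
     C1_Icc T1 T2 u \<and> C1_Icc T1 T2 (\<lambda>t. p t * D T1 T2 u t) \<and>
     (\<forall>t\<in>{T1<..<T2}. L T1 T2 p q u t = g t) \<and>
     u T1 = 0 \<and> u T2 = 0"

definition fucik_solution ::
  "real \<Rightarrow> real \<Rightarrow> (real \<Rightarrow> real) \<Rightarrow> (real \<Rightarrow> real) \<Rightarrow> (real \<Rightarrow> real) \<Rightarrow> (real \<Rightarrow> real)
    \<Rightarrow> real \<Rightarrow> real \<Rightarrow> (real \<Rightarrow> real) \<Rightarrow> bool" where
  "fucik_solution T1 T2 p q m n a b u \<longleftrightarrow>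
     dirichlet_solution T1 T2 p q (\<lambda>t. a * m t * pos_part u t - b * n t * neg_part u t) u"

definition eigenvalue ::
  "real \<Rightarrow> real \<Rightarrow> (real \<Rightarrow> real) \<Rightarrow> (real \<Rightarrow> real) \<Rightarrow> (real \<Rightarrow> real) \<Rightarrow> real \<Rightarrow> bool" where
  "eigenvalue T1 T2 p q m l \<longleftrightarrow>
     (\<exists>u. dirichlet_solution T1 T2 p q (\<lambda>t. l * m t * u t) u \<and> (\<exists>t\<in>{T1..T2}. u t \<noteq> 0))"

text \<open>
  The value of \<open>lambda1\<close> is meaningful only if a smallest positive eigenvalue exists, that is, if
  the weight \<open>m\<close> is positive somewhere in the open interval.
\<close>

definition lambda1 ::
  "real \<Rightarrow> real \<Rightarrow> (real \<Rightarrow> real) \<Rightarrow> (real \<Rightarrow> real) \<Rightarrow> (real \<Rightarrow> real) \<Rightarrow> real" where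
  "lambda1 T1 T2 p q m = (LEAST l. 0 < l \<and> eigenvalue T1 T2 p q m l)"

definition exactly_zeros :: "real \<Rightarrow> real \<Rightarrow> nat \<Rightarrow> (real \<Rightarrow> real) \<Rightarrow> bool" where
  "exactly_zeros T1 T2 j u \<longleftrightarrow>
     finite {t \<in> {T1<..<T2}. u t = 0} \<and> card {t \<in> {T1<..<T2}. u t = 0} = j"

text \<open>The sets \<open>C_gt \<dots> k\<close> and \<open>C_lt \<dots> k\<close> below are meant for \<open>k \<ge> 1\<close> (truncated subtraction).\<close>

definition C_gt ::
  "real \<Rightarrow> real \<Rightarrow> (real \<Rightarrow> real) \<Rightarrow> (real \<Rightarrow> real) \<Rightarrow> (real \<Rightarrow> real) \<Rightarrow> (real \<Rightarrow> real)
    \<Rightarrow> nat \<Rightarrow> (real \<times> real) set" where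
  "C_gt T1 T2 p q m n k =
     {(a, b). \<exists>u. fucik_solution T1 T2 p q m n a b u \<and> exactly_zeros T1 T2 (k - 1) u \<and>
        D T1 T2 u T1 > 0}"

definition C_lt ::
  "real \<Rightarrow> real \<Rightarrow> (real \<Rightarrow> real) \<Rightarrow> (real \<Rightarrow> real) \<Rightarrow> (real \<Rightarrow> real) \<Rightarrow> (real \<Rightarrow> real)
    \<Rightarrow> nat \<Rightarrow> (real \<times> real) set" where
  "C_lt T1 T2 p q m n k =
     {(a, b). \<exists>u. fucik_solution T1 T2 p q m n a b u \<and> exactly_zeros T1 T2 (k - 1) u \<and>
        D T1 T2 u T1 < 0}"

definition C_gt_pp ::
  "real \<Rightarrow> real \<Rightarrow> (real \<Rightarrow> real) \<Rightarrow> (real \<Rightarrow> real) \<Rightarrow> (real \<Rightarrow> real) \<Rightarrow> (real \<Rightarrow> real)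
    \<Rightarrow> nat \<Rightarrow> (real \<times> real) set" where
  "C_gt_pp T1 T2 p q m n k = C_gt T1 T2 p q m n k \<inter> ({0<..} \<times> {0<..})"

definition C_lt_pp ::
  "real \<Rightarrow> real \<Rightarrow> (real \<Rightarrow> real) \<Rightarrow> (real \<Rightarrow> real) \<Rightarrow> (real \<Rightarrow> real) \<Rightarrow> (real \<Rightarrow> real)
    \<Rightarrow> nat \<Rightarrow> (real \<times> real) set" where
  "C_lt_pp T1 T2 p q m n k = C_lt T1 T2 p q m n k \<inter> ({0<..} \<times> {0<..})"

end

theory Submission
  imports Defs
begin

text \<open>
  In polar (Pruefer) coordinates \<open>u = r sin \<theta>\<close>, \<open>p u' = r cos \<theta>\<close> the angle of a solution of
  \<open>L u = a m u\<^sup>+ - b n u\<^sup>-\<close> obeys a scalar first-order equation by itself, because the sign of \<open>u\<close>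
  is the sign of \<open>sin \<theta>\<close>. Start it at \<open>\<theta> T1 = 0\<close> and write \<open>\<Theta> (a, b)\<close> for \<open>\<theta> T2\<close>. Wherever \<open>\<theta>\<close> is a
  multiple of \<open>\<pi>\<close> its derivative is \<open>1 / p > 0\<close>, so each multiple is passed at most once and only
  upwards; hence \<open>(a, b)\<close> lies in \<open>C_gt\<close> for \<open>k\<close> exactly when \<open>\<Theta> (a, b) = k \<pi>\<close>
  (\<open>C_gt_iff_angle\<close>). The theorem is then about a level curve of \<open>\<Theta>\<close> in the open quadrant.

  For weights that change sign \<open>\<Theta>\<close> need not be monotone, but it increases in both variables at every
  point of the level \<open>k \<pi>\<close>. Indeed \<open>\<partial>\<Theta>/\<partial>a\<close> is a positive multiple of \<open>\<integral> m (u\<^sup>+)\<^sup>2\<close>, and when \<open>u\<close>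
  vanishes at both ends, testing the equation with \<open>u\<^sup>+\<close> gives
  \<open>a \<integral> m (u\<^sup>+)\<^sup>2 = \<integral> p ((u\<^sup>+)')\<^sup>2 + q (u\<^sup>+)\<^sup>2 > 0\<close>; the same holds for \<open>b\<close> and \<open>u\<^sup>-\<close>
  (\<open>energy_pos\<close>, \<open>sens_diag_pos\<close>). A continuous function that crosses a level only upwards
  crosses it at most once, so this local information decides on which side of the level a point lies.

  If \<open>\<Theta> (a, b) \<ge> 2 \<pi>\<close>, the solution has a complete positive arc and a complete negative arc. Comparing each
  with the solution of the linear problem with the same weight shows that \<open>a\<close> and \<open>b\<close> are at least the
  first eigenvalues of the two linear problems (\<open>lambda1_thresholds\<close>). These lower bounds
  supply the sign changes for the intermediate value theorem: once the level curve has a point over \<open>a\<close>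
  it has one over every larger \<open>a\<close>, and by continuity over some smaller \<open>a\<close>. So its projections to both axes are open
  rays.

  Smoothness comes from an exact difference formula in place of the implicit function theorem: for any two
  parameter pairs, \<open>\<Theta> P - \<Theta> Q\<close> is a linear combination of the coordinates of \<open>P - Q\<close> with coefficients that are
  continuous in \<open>(P, Q)\<close> (\<open>angle_T2_difference\<close>). Along a level curve the combination
  vanishes, which yields the difference quotients of the curve explicitly (\<open>level_curve\<close>).

  The sets \<open>C_lt\<close> reduce to the same situation through \<open>u \<mapsto> -u\<close>, which exchanges the roles of
  \<open>(a, m)\<close> and \<open>(b, n)\<close>.
\<close>

section \<open>Functions that cross a level only upwards\<close>

text \<open>
  If \<open>g y \<le> 0\<close> while \<open>g\<close> is positive just after \<open>x\<close>, the first later point with \<open>g \<le> 0\<close> is a zero of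
  \<open>g\<close> approached from positive values, against the positive derivative there.
\<close>

lemma upcrossing_pos:
  fixes g :: "real \<Rightarrow> real"
  assumes cont: "continuous_on {x..y} g"
    and up: "\<And>z. z \<in> {x..y} \<Longrightarrow> g z = 0 \<Longrightarrow>
      \<exists>d>0. (g has_real_derivative d) (at z within {x..y})"
    and "x < y" "0 \<le> g x"
  shows "0 < g y"
proof (rule ccontr)
  assume neg: "\<not> 0 < g y"
  \<comment> \<open>A zero at \<open>x\<close> itself must not count as the first bad point, so start slightly to its right.\<close>
  obtain x' where x': "x \<le> x'" "x' < y" "0 < g x'"
  proof (cases "g x = 0")
    case True
    then obtain d where "0 < d" "(g has_real_derivative d) (at x within {x..y})"
      using up[of x] \<open>x < y\<close> by auto
    then obtain e where e: "e > 0"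
      and inc: "\<And>h. 0 < h \<Longrightarrow> x + h \<in> {x..y} \<Longrightarrow> h < e \<Longrightarrow> g x < g (x + h)"
      using has_real_derivative_pos_inc_right by blast
    define h where "h = min (e / 2) ((y - x) / 2)"
    have "0 < h" "h < e" "x + h < y"
      using \<open>x < y\<close> e by (auto simp: h_def min_def field_simps)
    then show ?thesis
      using inc[of h] that[of "x + h"] True by auto
  next
    case False
    then show ?thesis using that[of x] assms by auto
  qed
  define S where "S = {s \<in> {x'..y}. g s \<le> 0}"
  have "continuous_on {x'..y} g"
    using cont x' by (auto intro: continuous_on_subset)
  then have "closed S"
    unfolding S_def using continuous_on_closed_Collect_le[of "{x'..y}" g "\<lambda>_. 0"] by auto
  have "y \<in> S" using neg x' by (auto simp: S_def)
  have bdd: "bdd_below S" by (auto simp: S_def)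
  define z where "z = Inf S"
  have "z \<in> S"
    unfolding z_def using \<open>closed S\<close> \<open>y \<in> S\<close> bdd by (intro closed_contains_Inf) auto
  then have z: "x' < z" "z \<le> y" "g z \<le> 0"
    using x' by (auto simp: S_def less_le)
  have before: "0 < g s" if "x' \<le> s" "s < z" for s
    using that z cInf_lower[of s S] bdd by (force simp: S_def z_def)
  have "g z = 0"
  proof (rule ccontr)
    assume "g z \<noteq> 0"
    with z have "g z < 0" by auto
    moreover have "continuous_on {x'..z} g"
      using cont x' z by (auto intro: continuous_on_subset)
    ultimately obtain s where "x' \<le> s" "s \<le> z" "g s = 0"
      using IVT2'[of g z 0 x'] x' z by auto
    then show False using before[of s] \<open>g z < 0\<close> by (cases "s = z") auto
  qed
  then obtain d where "0 < d" "(g has_real_derivative d) (at z within {x..y})"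
    using up[of z] z x' by auto
  then obtain e where e: "e > 0"
    and inc: "\<And>h. 0 < h \<Longrightarrow> z - h \<in> {x..y} \<Longrightarrow> h < e \<Longrightarrow> g (z - h) < g z"
    using has_real_derivative_pos_inc_left by blast
  define h where "h = min (e / 2) ((z - x') / 2)"
  have "0 < h" "h < e" "x' < z - h"
    using z e by (auto simp: h_def min_def field_simps)
  then have "g (z - h) < 0" "0 < g (z - h)"
    using inc[of h] before[of "z - h"] \<open>g z = 0\<close> x' z by auto
  then show False by simp
qed

section \<open>Integrals and linear scalar equations\<close>

lemma continuous_on_Icc_bounded:
  fixes h :: "real \<Rightarrow> real"
  assumes "continuous_on {a..b} h"
  obtains K where "0 \<le> K" "\<And>t. t \<in> {a..b} \<Longrightarrow> \<bar>h t\<bar> \<le> K"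
proof -
  have "bounded (h ` {a..b})"
    by (intro compact_imp_bounded compact_continuous_image assms compact_Icc)
  then obtain K where "\<forall>y\<in>h ` {a..b}. norm y \<le> K" unfolding bounded_iff by blast
  then have "\<bar>h t\<bar> \<le> max 0 K" if "t \<in> {a..b}" for t
    using that by (simp add: le_max_iff_disj)
  then show ?thesis using that[of "max 0 K"] by simp
qed

text \<open>
  The domain of integration varies with \<open>t\<close>. Freezing the integrand after time \<open>t\<close> turns it into an
  integral over the fixed interval \<open>{a..b}\<close>, up to the explicit term \<open>(b - t) * f x t\<close>.
\<close>

lemma continuous_on_integral_Icc:
  fixes f :: "'a::topological_space \<Rightarrow> real \<Rightarrow> real"
  assumes f: "continuous_on (UNIV \<times> {a..b}) (\<lambda>(x, t). f x t)"
  shows "continuous_on (UNIV \<times> {a..b}) (\<lambda>(x, t). integral {a..t} (f x))"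
proof -
  have cf: "continuous_on {a..b} (f x)" for x
  proof -
    have "continuous_on {a..b} (\<lambda>t. (x, t))" by (intro continuous_intros)
    from continuous_on_compose2[OF f this] show ?thesis by auto
  qed
  have eq: "integral {a..t} (f x) = integral (cbox a b) (\<lambda>s. f x (min s t)) - (b - t) * f x t"
    if t: "t \<in> {a..b}" for x t
  proof -
    have c: "continuous_on {a..b} (\<lambda>s. f x (min s t))"
      by (rule continuous_on_compose2[OF cf]) (use t in \<open>auto intro!: continuous_intros\<close>)
    have "integral {a..b} (\<lambda>s. f x (min s t)) =
        integral {a..t} (\<lambda>s. f x (min s t)) + integral {t..b} (\<lambda>s. f x (min s t))"
      using Henstock_Kurzweil_Integration.integral_combine[of a t b "\<lambda>s. f x (min s t)"] t
        integrable_continuous_real[OF c] by auto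
    also have "integral {a..t} (\<lambda>s. f x (min s t)) = integral {a..t} (f x)"
      by (rule integral_cong) (auto simp: min_def)
    also have "integral {t..b} (\<lambda>s. f x (min s t)) = integral {t..b} (\<lambda>s. f x t)"
      by (rule integral_cong) (auto simp: min_def)
    also have "\<dots> = (b - t) * f x t"
      using t by simp
    finally show ?thesis by simp
  qed
  have "continuous_on ((UNIV \<times> {a..b}) \<times> cbox a b) (\<lambda>(y, s). f (fst y) (min s (snd y)))"
  proof -
    have "continuous_on ((UNIV \<times> {a..b}) \<times> cbox a b)
        (\<lambda>z. (fst (fst z), min (snd z) (snd (fst z))))"
      by (intro continuous_intros)
    from continuous_on_compose2[OF f this] show ?thesis
      by (auto simp: case_prod_beta image_subset_iff min_le_iff_disj)
  qed
  then have "continuous_on (UNIV \<times> {a..b})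
      (\<lambda>y. integral (cbox a b) (\<lambda>s. f (fst y) (min s (snd y))))"
    by (rule integral_continuous_on_param)
  moreover have "continuous_on (UNIV \<times> {a..b}) (\<lambda>y. f (fst y) (snd y))"
    using f by (simp add: case_prod_beta)
  ultimately have "continuous_on (UNIV \<times> {a..b})
      (\<lambda>y. integral (cbox a b) (\<lambda>s. f (fst y) (min s (snd y))) - (b - snd y) * f (fst y) (snd y))"
    by (intro continuous_intros)
  then show ?thesis
    by (rule iffD1[OF continuous_on_cong, rotated -1]) (auto simp: eq)
qed

lemma DERIV_zero_Icc_const:
  fixes g :: "real \<Rightarrow> real"
  assumes "\<And>t. t \<in> {a..b} \<Longrightarrow> (g has_real_derivative 0) (at t within {a..b})" "t \<in> {a..b}"
  shows "g t = g a"
  using has_field_derivative_zero_constant[of "{a..b}" g] assms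
  by (metis atLeastAtMost_iff convex_real_interval(5) order_refl order_trans)

text \<open>Variation of constants: the difference of two angle functions solves such an equation.\<close>

lemma linear_ode_solution:
  fixes w G h :: "real \<Rightarrow> real"
  assumes G: "continuous_on {a..b} G" and h: "continuous_on {a..b} h"
    and w: "\<And>t. t \<in> {a..b} \<Longrightarrow> (w has_real_derivative G t * w t + h t) (at t within {a..b})"
    and t: "t \<in> {a..b}"
  shows "w t = exp (integral {a..t} G) *
    (w a + integral {a..t} (\<lambda>s. exp (- integral {a..s} G) * h s))"
proof -
  define I where "I t = integral {a..t} G" for t
  have I: "(I has_real_derivative G t) (at t within {a..b})" if "t \<in> {a..b}" for t
    unfolding I_def by (rule integral_has_real_derivative[OF G that])
  have cI: "continuous_on {a..b} I"
    by (rule DERIV_continuous_on[OF I])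
  define J where "J t = integral {a..t} (\<lambda>s. exp (- I s) * h s)" for t
  have J: "(J has_real_derivative exp (- I t) * h t) (at t within {a..b})" if "t \<in> {a..b}" for t
    unfolding J_def
    by (rule integral_has_real_derivative[OF _ that]) (intro continuous_intros cI h)
  define g where "g t = exp (- I t) * w t - J t" for t
  have "(g has_real_derivative 0) (at t within {a..b})" if "t \<in> {a..b}" for t
    unfolding g_def
    by (rule derivative_eq_intros I[OF that] J[OF that] w[OF that] refl)+
      (simp add: algebra_simps)
  then have "g t = g a"
    by (rule DERIV_zero_Icc_const) (use t in auto)
  then have "exp (- I t) * w t = w a + J t"
    by (simp add: g_def I_def J_def)
  then have "exp (I t) * (exp (- I t) * w t) = exp (I t) * (w a + J t)"
    by simp
  then have "w t = exp (I t) * (w a + J t)"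
    by (simp add: mult.assoc[symmetric] exp_add[symmetric])
  then show ?thesis unfolding I_def J_def .
qed

lemma linear_ode_nonneg:
  fixes w G h :: "real \<Rightarrow> real"
  assumes G: "continuous_on {a..b} G" and h: "continuous_on {a..b} h"
    and w: "\<And>t. t \<in> {a..b} \<Longrightarrow> (w has_real_derivative G t * w t + h t) (at t within {a..b})"
    and t: "t \<in> {a..b}"
    and h0: "\<And>t. t \<in> {a..b} \<Longrightarrow> 0 \<le> h t"
  shows "0 \<le> w a \<Longrightarrow> 0 \<le> w t" and "0 < w a \<Longrightarrow> 0 < w t"
proof -
  have "0 \<le> integral {a..t} (\<lambda>s. exp (- integral {a..s} G) * h s)"
  proof (rule Henstock_Kurzweil_Integration.integral_nonneg)
    have "continuous_on {a..b} (\<lambda>s. integral {a..s} G)"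
      by (rule DERIV_continuous_on[OF integral_has_real_derivative[OF G]])
    then have "continuous_on {a..b} (\<lambda>s. exp (- integral {a..s} G) * h s)"
      by (intro continuous_intros h)
    then show "(\<lambda>s. exp (- integral {a..s} G) * h s) integrable_on {a..t}"
      using t by (intro integrable_continuous_real) (auto intro: continuous_on_subset)
  qed (use t h0 in auto)
  then show "0 \<le> w a \<Longrightarrow> 0 \<le> w t" and "0 < w a \<Longrightarrow> 0 < w t"
    using linear_ode_solution[OF G h w t] by (auto intro!: mult_nonneg_nonneg mult_pos_pos)
qed

text \<open>
  What matters is that the bound is proportional to \<open>M\<close>: this gives Lipschitz dependence on parameters.
\<close>

lemma linear_ode_bound:
  fixes w G h :: "real \<Rightarrow> real"
  assumes G: "continuous_on {a..b} G" and h: "continuous_on {a..b} h"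
    and w: "\<And>t. t \<in> {a..b} \<Longrightarrow> (w has_real_derivative G t * w t + h t) (at t within {a..b})"
    and t: "t \<in> {a..b}"
    and GK: "\<And>t. t \<in> {a..b} \<Longrightarrow> \<bar>G t\<bar> \<le> K" and hM: "\<And>t. t \<in> {a..b} \<Longrightarrow> \<bar>h t\<bar> \<le> M"
    and w0: "w a = 0"
  shows "\<bar>w t\<bar> \<le> exp (2 * K * (b - a)) * (b - a) * M"
proof -
  define I where "I t = integral {a..t} G" for t
  have KM: "0 \<le> K" "0 \<le> M" using GK[OF t] hM[OF t] by auto
  have cI: "continuous_on {a..b} I"
    unfolding I_def by (rule DERIV_continuous_on[OF integral_has_real_derivative[OF G]])
  have Ib: "\<bar>I s\<bar> \<le> K * (b - a)" if s: "s \<in> {a..b}" for s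
  proof -
    have "norm (I s) \<le> K * (s - a)"
      unfolding I_def using s GK
      by (intro integral_bound) (auto intro: continuous_on_subset[OF G])
    also have "\<dots> \<le> K * (b - a)" using s KM by (intro mult_left_mono) auto
    finally show ?thesis by simp
  qed
  have "norm (integral {a..t} (\<lambda>s. exp (- I s) * h s)) \<le> (exp (K * (b - a)) * M) * (t - a)"
  proof (rule integral_bound)
    show "continuous_on {a..t} (\<lambda>s. exp (- I s) * h s)"
      using t by (auto intro!: continuous_intros continuous_on_subset[OF cI] continuous_on_subset[OF h])
    show "norm (exp (- I s) * h s) \<le> exp (K * (b - a)) * M" if "s \<in> {a..t}" for s
      using that t hM[of s] Ib[of s] by (auto simp: abs_mult intro!: mult_mono)
  qed (use t in auto)
  also have "\<dots> \<le> (exp (K * (b - a)) * M) * (b - a)"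
    using t KM by (intro mult_left_mono) auto
  finally have J: "\<bar>integral {a..t} (\<lambda>s. exp (- I s) * h s)\<bar> \<le> exp (K * (b - a)) * M * (b - a)"
    by simp
  have "\<bar>w t\<bar> = exp (I t) * \<bar>integral {a..t} (\<lambda>s. exp (- I s) * h s)\<bar>"
    using linear_ode_solution[OF G h w t] w0 by (simp add: I_def abs_mult)
  also have "\<dots> \<le> exp (K * (b - a)) * (exp (K * (b - a)) * M * (b - a))"
    using J Ib[OF t] by (intro mult_mono) auto
  also have "\<dots> = exp (2 * K * (b - a)) * (b - a) * M"
    by (simp add: exp_add[symmetric] mult.assoc[symmetric] flip: exp_add) 
  finally show ?thesis .
qed

section \<open>Level curves of functions that increase across the level\<close>

lemma up_closed_open_ray:
  fixes X :: "real set"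
  assumes "X \<noteq> {}" and lb: "\<And>x. x \<in> X \<Longrightarrow> \<alpha> \<le> x"
    and up: "\<And>x y. x \<in> X \<Longrightarrow> x < y \<Longrightarrow> y \<in> X"
    and no_min: "\<And>x. x \<in> X \<Longrightarrow> \<exists>y\<in>X. y < x"
  shows "\<exists>\<nu>\<ge>\<alpha>. X = {\<nu><..}"
proof (intro exI conjI)
  have bdd: "bdd_below X" using lb by (rule bdd_belowI)
  show "\<alpha> \<le> Inf X" using assms(1) lb by (intro cInf_greatest) auto
  show "X = {Inf X<..}"
  proof safe
    fix x assume "x \<in> X"
    then obtain y where "y \<in> X" "y < x" using no_min by blast
    then show "Inf X < x" using cInf_lower[OF _ bdd, of y] by simp
  next
    fix x assume "Inf X < x"
    then obtain y where "y \<in> X" "y < x" using cInf_less_iff[OF assms(1) bdd] by blast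
    then show "x \<in> X" by (rule up)
  qed
qed

text \<open>
  The coefficients \<open>A\<close> and \<open>B\<close> act as difference quotients of \<open>\<Theta>\<close> and are its partial derivatives on the
  diagonal. Since those are positive on the level, \<open>\<Theta>\<close> crosses the level at most once along every horizontal
  or vertical line; the bounds \<open>\<alpha>\<close> and \<open>\<beta>\<close> force \<open>\<Theta>\<close> below the level near the axes, so that a crossing exists
  as soon as \<open>\<Theta>\<close> reaches the level somewhere on the line.
\<close>

lemma level_curve:
  fixes \<Theta> :: "real \<times> real \<Rightarrow> real" and A B :: "(real \<times> real) \<times> (real \<times> real) \<Rightarrow> real"
  assumes diff: "\<And>P Q. \<Theta> P - \<Theta> Q = (fst P - fst Q) * A (P, Q) + (snd P - snd Q) * B (P, Q)"
    and cA: "continuous_on UNIV A" and cB: "continuous_on UNIV B"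
    and pos: "\<And>a b. 0 < a \<Longrightarrow> 0 < b \<Longrightarrow> \<Theta> (a, b) = c \<Longrightarrow>
      0 < A ((a, b), (a, b)) \<and> 0 < B ((a, b), (a, b))"
    and low: "\<And>a b. 0 < a \<Longrightarrow> 0 < b \<Longrightarrow> c \<le> \<Theta> (a, b) \<Longrightarrow> 0 < \<alpha> \<and> \<alpha> \<le> a \<and> 0 < \<beta> \<and> \<beta> \<le> b"
    and S: "S = {(a, b). 0 < a \<and> 0 < b \<and> \<Theta> (a, b) = c}" "S \<noteq> {}"
  shows "\<exists>\<nu> \<mu>. \<exists>f :: real \<Rightarrow> real. \<nu> \<ge> \<alpha> \<and> \<mu> \<ge> \<beta> \<and>
      strict_antimono_on {\<nu><..} f \<and> f C1_differentiable_on {\<nu><..} \<and>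
      f ` {\<nu><..} = {\<mu><..} \<and> (\<forall>x\<in>{\<nu><..}. deriv f x < 0) \<and>
      S = {(x, f x) | x. x \<in> {\<nu><..}}"
proof -
  have contA: "continuous_on T (\<lambda>x. A (u x))" if "continuous_on T u" for T :: "real set" and u
    by (rule continuous_on_compose2[OF cA that]) auto
  have contB: "continuous_on T (\<lambda>x. B (u x))" if "continuous_on T u" for T :: "real set" and u
    by (rule continuous_on_compose2[OF cB that]) auto
  have da: "((\<lambda>x. \<Theta> (x, b)) has_real_derivative A ((a, b), (a, b))) (at a)" for a b
    unfolding CARAT_DERIV
  proof (intro exI conjI allI)
    show "\<Theta> (z, b) - \<Theta> (a, b) = A ((z, b), (a, b)) * (z - a)" for z
      using diff[of "(z, b)" "(a, b)"] by simp
    have "continuous_on UNIV (\<lambda>z. A ((z, b), (a, b)))" by (intro contA continuous_intros)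
    then show "isCont (\<lambda>z. A ((z, b), (a, b))) a" by (simp add: continuous_on_eq_continuous_at)
  qed simp
  have db: "((\<lambda>x. \<Theta> (a, x)) has_real_derivative B ((a, b), (a, b))) (at b)" for a b
    unfolding CARAT_DERIV
  proof (intro exI conjI allI)
    show "\<Theta> (a, z) - \<Theta> (a, b) = B ((a, z), (a, b)) * (z - b)" for z
      using diff[of "(a, z)" "(a, b)"] by simp
    have "continuous_on UNIV (\<lambda>z. B ((a, z), (a, b)))" by (intro contB continuous_intros)
    then show "isCont (\<lambda>z. B ((a, z), (a, b))) b" by (simp add: continuous_on_eq_continuous_at)
  qed simp
  have ca: "continuous_on T (\<lambda>x. \<Theta> (x, b))" and cb: "continuous_on T (\<lambda>x. \<Theta> (b, x))" for T b
    by (intro DERIV_continuous_on[OF has_field_derivative_at_within[OF da]]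
        DERIV_continuous_on[OF has_field_derivative_at_within[OF db]])+
  have up_a: "c < \<Theta> (a', b)" if "0 < a" "0 < b" "a < a'" "c \<le> \<Theta> (a, b)" for a a' b
  proof -
    have "0 < \<Theta> (a', b) - c"
    proof (rule upcrossing_pos[of a a' "\<lambda>x. \<Theta> (x, b) - c"])
      fix z assume z: "z \<in> {a..a'}" "\<Theta> (z, b) - c = 0"
      have "((\<lambda>x. \<Theta> (x, b) - c) has_real_derivative A ((z, b), (z, b))) (at z within {a..a'})"
        by (rule derivative_eq_intros has_field_derivative_at_within[OF da] refl)+ simp
      then show "\<exists>d>0. ((\<lambda>x. \<Theta> (x, b) - c) has_real_derivative d) (at z within {a..a'})"
        using pos[of z b] that z by auto
    qed (use that in \<open>auto intro!: continuous_intros ca\<close>)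
    then show ?thesis by simp
  qed
  have up_b: "c < \<Theta> (a, b')" if "0 < a" "0 < b" "b < b'" "c \<le> \<Theta> (a, b)" for a b b'
  proof -
    have "0 < \<Theta> (a, b') - c"
    proof (rule upcrossing_pos[of b b' "\<lambda>x. \<Theta> (a, x) - c"])
      fix z assume z: "z \<in> {b..b'}" "\<Theta> (a, z) - c = 0"
      have "((\<lambda>x. \<Theta> (a, x) - c) has_real_derivative B ((a, z), (a, z))) (at z within {b..b'})"
        by (rule derivative_eq_intros has_field_derivative_at_within[OF db] refl)+ simp
      then show "\<exists>d>0. ((\<lambda>x. \<Theta> (a, x) - c) has_real_derivative d) (at z within {b..b'})"
        using pos[of a z] that z by auto
    qed (use that in \<open>auto intro!: continuous_intros cb\<close>)
    then show ?thesis by simp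
  qed
  have root_b: "\<exists>b'. (a, b') \<in> S" if "0 < a" "0 < b" "c \<le> \<Theta> (a, b)" for a b
  proof -
    have \<beta>: "0 < \<beta>" "\<beta> \<le> b" using low[OF that] by auto
    then have "\<Theta> (a, \<beta> / 2) \<le> c" using low[of a "\<beta> / 2"] that by force
    then have "\<exists>b'\<ge>\<beta> / 2. b' \<le> b \<and> \<Theta> (a, b') = c"
      using that \<beta> by (intro IVT'[where f = "\<lambda>x. \<Theta> (a, x)"] cb) auto
    then obtain b' where "\<beta> / 2 \<le> b'" "\<Theta> (a, b') = c" by blast
    then show ?thesis using \<beta> that by (intro exI[of _ b']) (auto simp: S)
  qed
  have root_a: "\<exists>a'. (a', b) \<in> S" if "0 < a" "0 < b" "c \<le> \<Theta> (a, b)" for a b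
  proof -
    have \<alpha>: "0 < \<alpha>" "\<alpha> \<le> a" using low[OF that] by auto
    then have "\<Theta> (\<alpha> / 2, b) \<le> c" using low[of "\<alpha> / 2" b] that by force
    then have "\<exists>a'\<ge>\<alpha> / 2. a' \<le> a \<and> \<Theta> (a', b) = c"
      using that \<alpha> by (intro IVT'[where f = "\<lambda>x. \<Theta> (x, b)"] ca) auto
    then obtain a' where "\<alpha> / 2 \<le> a'" "\<Theta> (a', b) = c" by blast
    then show ?thesis using \<alpha> that by (intro exI[of _ a']) (auto simp: S)
  qed
  \<comment> \<open>A strict inequality survives a small move to the left: the projections have no least element.\<close>
  have left: "\<exists>y. 0 < y \<and> y < x \<and> c < g y" if "0 < x" "c < g x" "continuous_on UNIV g"
    for g and x :: real
  proof -
    have "open {y. 0 < y \<and> c < g y}" "x \<in> {y. 0 < y \<and> c < g y}"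
      using that by (auto intro!: open_Collect_conj open_Collect_less continuous_intros)
    then obtain e where e: "0 < e" "\<And>y. dist y x < e \<Longrightarrow> y \<in> {y. 0 < y \<and> c < g y}"
      unfolding open_dist by blast
    have "dist (x - e / 2) x < e" using e(1) by (simp add: dist_real_def)
    from e(2)[OF this] have "x - e / 2 \<in> {y. 0 < y \<and> c < g y}" .
    then show ?thesis using e(1) by (intro exI[of _ "x - e / 2"]) auto
  qed
  have "\<exists>\<nu>\<ge>\<alpha>. {a. \<exists>b. (a, b) \<in> S} = {\<nu><..}"
  proof (rule up_closed_open_ray)
    fix a assume "a \<in> {a. \<exists>b. (a, b) \<in> S}"
    then obtain b where ab: "0 < a" "0 < b" "\<Theta> (a, b) = c" by (auto simp: S)
    then show "\<alpha> \<le> a" using low[of a b] by auto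
    show "a' \<in> {a. \<exists>b. (a, b) \<in> S}" if "a < a'" for a'
      using root_b[of a' b] up_a[of a b a'] ab that by auto
    have "c < \<Theta> (a, b + 1)" using up_b[of a b "b + 1"] ab by auto
    then obtain a' where "0 < a'" "a' < a" "c < \<Theta> (a', b + 1)"
      using left[of a "\<lambda>x. \<Theta> (x, b + 1)"] ab ca by auto
    then show "\<exists>y\<in>{a. \<exists>b. (a, b) \<in> S}. y < a"
      using root_b[of a' "b + 1"] ab by auto
  qed (use S(2) in auto)
  then obtain \<nu> where "\<alpha> \<le> \<nu>" and \<nu>: "\<And>a. (\<exists>b. (a, b) \<in> S) \<longleftrightarrow> \<nu> < a" by blast
  have "\<exists>\<mu>\<ge>\<beta>. {b. \<exists>a. (a, b) \<in> S} = {\<mu><..}"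
  proof (rule up_closed_open_ray)
    fix b assume "b \<in> {b. \<exists>a. (a, b) \<in> S}"
    then obtain a where ab: "0 < a" "0 < b" "\<Theta> (a, b) = c" by (auto simp: S)
    then show "\<beta> \<le> b" using low[of a b] by auto
    show "b' \<in> {b. \<exists>a. (a, b) \<in> S}" if "b < b'" for b'
      using root_a[of a b'] up_b[of a b b'] ab that by auto
    have "c < \<Theta> (a + 1, b)" using up_a[of a b "a + 1"] ab by auto
    then obtain b' where "0 < b'" "b' < b" "c < \<Theta> (a + 1, b')"
      using left[of b "\<lambda>x. \<Theta> (a + 1, x)"] ab cb by auto
    then show "\<exists>y\<in>{b. \<exists>a. (a, b) \<in> S}. y < b"
      using root_a[of "a + 1" b'] ab by auto
  qed (use S(2) in auto)
  then obtain \<mu> where "\<beta> \<le> \<mu>" and \<mu>: "\<And>b. (\<exists>a. (a, b) \<in> S) \<longleftrightarrow> \<mu> < b" by blast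
  define f where "f a = (SOME b. (a, b) \<in> S)" for a
  have f: "(a, f a) \<in> S" if "\<nu> < a" for a
    unfolding f_def using \<nu>[of a] that by (auto intro: someI_ex)
  have unique: "b = f a" if "(a, b) \<in> S" for a b
  proof -
    have "(a, f a) \<in> S" using that \<nu>[of a] f by blast
    then show ?thesis
      using that up_b[of a b "f a"] up_b[of a "f a" b] by (auto simp: S intro: linorder_cases[of b "f a"])
  qed
  have Sf: "S = {(x, f x) | x. x \<in> {\<nu><..}}"
    using f unique \<nu> by fastforce
  have anti: "f y < f x" if "\<nu> < x" "x < y" for x y
  proof (rule ccontr)
    assume "\<not> f y < f x"
    have x: "0 < x" "0 < f x" "\<Theta> (x, f x) = c" and y: "0 < y" "0 < f y" "\<Theta> (y, f y) = c"
      using f[of x] f[of y] that by (auto simp: S)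
    then have "c < \<Theta> (y, f x)" using up_a[of x "f x" y] that by auto
    moreover have "f x = f y \<or> f x < f y" using \<open>\<not> f y < f x\<close> by auto
    ultimately have "c < \<Theta> (y, f y)" using up_b[of y "f x" "f y"] x y by auto
    then show False using y by simp
  qed
  have img: "f ` {\<nu><..} = {\<mu><..}"
    using \<mu> unfolding Sf by auto
  \<comment> \<open>A monotone function whose image is an open ray cannot jump.\<close>
  have cf: "continuous_on {\<nu><..} f"
  proof -
    have "continuous_on {\<nu><..} (\<lambda>x. - f x)"
    proof (rule continuous_onI_mono)
      have "(\<lambda>x. - f x) ` {\<nu><..} = uminus ` {\<mu><..}"
        using img by (metis image_image)
      then show "open ((\<lambda>x. - f x) ` {\<nu><..})" by simp
      fix x y assume "x \<in> {\<nu><..}" "y \<in> {\<nu><..}" "x \<le> y"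
      then show "- f x \<le> - f y" using anti[of x y] by (cases "x = y") auto
    qed
    from continuous_on_minus[OF this] show ?thesis by simp
  qed
  define d where "d x = - A ((x, f x), (x, f x)) / B ((x, f x), (x, f x))" for x
  have posx: "0 < A ((x, f x), (x, f x))" "0 < B ((x, f x), (x, f x))" if "\<nu> < x" for x
    using f[OF that] pos[of x "f x"] by (auto simp: S)
  have df: "(f has_real_derivative d x) (at x)" if x: "\<nu> < x" for x
    unfolding has_field_derivative_iff
  proof (rule Lim_transform_eventually)
    have ev: "\<forall>\<^sub>F z in at x. z \<in> {\<nu><..}"
      using x by (intro eventually_at_in_open') auto
    have "continuous_on {\<nu><..} (\<lambda>z. A ((z, f z), (x, f x)))"
      and "continuous_on {\<nu><..} (\<lambda>z. B ((z, f z), (x, f x)))"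
      by (intro contA contB continuous_intros cf)+
    then have A: "((\<lambda>z. A ((z, f z), (x, f x))) \<longlongrightarrow> A ((x, f x), (x, f x))) (at x)"
      and B: "((\<lambda>z. B ((z, f z), (x, f x))) \<longlongrightarrow> B ((x, f x), (x, f x))) (at x)"
      using x by (auto simp: continuous_on_eq_continuous_at isCont_def)
    show "((\<lambda>z. - A ((z, f z), (x, f x)) / B ((z, f z), (x, f x))) \<longlongrightarrow> d x) (at x)"
      unfolding d_def using posx[OF x] by (intro tendsto_intros A B) auto
    have "\<forall>\<^sub>F z in at x. 0 < B ((z, f z), (x, f x))"
      by (rule order_tendstoD(1)[OF B posx(2)[OF x]])
    moreover have "\<forall>\<^sub>F z in at x. z \<noteq> x" by (simp add: eventually_at_filter)
    \<comment> \<open>Both points lie on the level, so the difference formula reduces to a linear relation.\<close>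
    ultimately show "\<forall>\<^sub>F z in at x. - A ((z, f z), (x, f x)) / B ((z, f z), (x, f x)) =
        (f z - f x) / (z - x)"
      using ev
    proof eventually_elim
      case (elim z)
      have "\<Theta> (z, f z) = \<Theta> (x, f x)"
        using f[of z] f[of x] elim x by (auto simp: S)
      then have "(z - x) * A ((z, f z), (x, f x)) + (f z - f x) * B ((z, f z), (x, f x)) = 0"
        using diff[of "(z, f z)" "(x, f x)"] by simp
      then have "(f z - f x) * B ((z, f z), (x, f x)) = - A ((z, f z), (x, f x)) * (z - x)"
        by (simp add: algebra_simps)
      moreover have "- \<alpha>' / \<beta>' = \<xi> / \<eta>" if "\<xi> * \<beta>' = - \<alpha>' * \<eta>" "\<beta>' \<noteq> 0" "\<eta> \<noteq> 0"
        for \<alpha>' \<beta>' \<xi> \<eta> :: real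
        using that frac_eq_eq[of \<beta>' \<eta> "- \<alpha>'" \<xi>] by simp
      ultimately show ?case using elim by simp
    qed
  qed
  have "continuous_on {\<nu><..} d"
    unfolding d_def
    by (intro continuous_intros contA contB cf ballI) (use posx in force)
  then have "f C1_differentiable_on {\<nu><..}"
    unfolding C1_differentiable_on_def
    using df by (auto simp: has_real_derivative_iff_has_vector_derivative)
  moreover have "\<forall>x\<in>{\<nu><..}. deriv f x < 0"
    using df DERIV_imp_deriv posx by (fastforce simp: d_def)
  moreover have "strict_antimono_on {\<nu><..} f"
    using anti by (auto intro!: monotone_onI)
  ultimately show ?thesis
    using \<open>\<alpha> \<le> \<nu>\<close> \<open>\<beta> \<le> \<mu>\<close> img Sf by blast
qed

section \<open>Existence for scalar equations\<close>

text \<open>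
  Picard iteration. Measured with the weight \<open>exp (2 * L * (t - a))\<close>, each step halves the distance of
  consecutive iterates on the whole interval at once.
\<close>

lemma scalar_ode_exists:
  fixes F :: "real \<Rightarrow> real \<Rightarrow> real"
  assumes F: "continuous_on ({a..b} \<times> UNIV) (\<lambda>(t, x). F t x)"
    and Lip: "\<And>t x y. t \<in> {a..b} \<Longrightarrow> \<bar>F t x - F t y\<bar> \<le> K * \<bar>x - y\<bar>"
    and ab: "a \<le> b"
  shows "\<exists>\<theta>. \<theta> a = x0 \<and>
    (\<forall>t\<in>{a..b}. (\<theta> has_real_derivative F t (\<theta> t)) (at t within {a..b}))"
proof -
  define L where "L = \<bar>K\<bar> + 1"
  have "0 < L" by (simp add: L_def)
  have Lip': "\<bar>F t x - F t y\<bar> \<le> L * \<bar>x - y\<bar>" if "t \<in> {a..b}" for t x y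
    using Lip[OF that, of x y] mult_right_mono[of K L "\<bar>x - y\<bar>"] unfolding L_def by linarith
  have comp: "continuous_on {a..b} (\<lambda>s. F s (g s))" if "continuous_on {a..b} g" for g
  proof -
    have "continuous_on {a..b} (\<lambda>s. (s, g s))" by (intro continuous_intros that)
    from continuous_on_compose2[OF F this] show ?thesis by auto
  qed
  define \<phi> where "\<phi> = rec_nat (\<lambda>_. x0) (\<lambda>_ g t. x0 + integral {a..t} (\<lambda>s. F s (g s)))"
  have \<phi>0: "\<phi> 0 = (\<lambda>_. x0)"
    and \<phi>S: "\<phi> (Suc i) t = x0 + integral {a..t} (\<lambda>s. F s (\<phi> i s))" for i t
    by (simp_all add: \<phi>_def)
  have cint: "continuous_on {a..b} (\<lambda>t. integral {a..t} (\<lambda>s. F s (g s)))"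
    if "continuous_on {a..b} g" for g
    by (rule DERIV_continuous_on[OF integral_has_real_derivative[OF comp[OF that]]])
  have c: "continuous_on {a..b} (\<phi> i)" for i
  proof (induction i)
    case (Suc i)
    have "\<phi> (Suc i) = (\<lambda>t. x0 + integral {a..t} (\<lambda>s. F s (\<phi> i s)))" by (auto simp: \<phi>S)
    then show ?case by (auto intro!: continuous_intros cint Suc)
  qed (simp add: \<phi>0)
  obtain M where "0 \<le> M" and M: "\<And>t. t \<in> {a..b} \<Longrightarrow> \<bar>\<phi> 1 t - \<phi> 0 t\<bar> \<le> M"
    using continuous_on_Icc_bounded[OF continuous_on_diff[OF c[of 1] c[of 0]]] by blast
  define B where "B = M * exp (2 * L * (b - a))"
  have step: "\<bar>\<phi> (Suc i) t - \<phi> i t\<bar> \<le> M * (1 / 2) ^ i * exp (2 * L * (t - a))"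
    if "t \<in> {a..b}" for i t
    using that
  proof (induction i arbitrary: t)
    case 0
    have "\<bar>\<phi> 1 t - \<phi> 0 t\<bar> \<le> M * 1" using M[OF 0] by simp
    also have "\<dots> \<le> M * exp (2 * L * (t - a))"
      using \<open>0 \<le> M\<close> \<open>0 < L\<close> 0 by (intro mult_left_mono) auto
    finally show ?case by simp
  next
    case (Suc i)
    define g where "g s = L * (M * (1 / 2) ^ i * exp (2 * L * (s - a)))" for s
    define H where "H s = M * (1 / 2) ^ Suc i * exp (2 * L * (s - a))" for s
    have sub: "{a..t} \<subseteq> {a..b}" using Suc.prems by auto
    have "(g has_integral (H t - H a)) {a..t}"
    proof (rule fundamental_theorem_of_calculus)
      show "(H has_vector_derivative g x) (at x within {a..t})" for x
        unfolding has_real_derivative_iff_has_vector_derivative[symmetric] H_def g_def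
        by (auto intro!: derivative_eq_intros)
    qed (use Suc.prems in auto)
    then have g: "g integrable_on {a..t}" "integral {a..t} g = H t - H a" by auto
    have int: "(\<lambda>s. F s (\<phi> j s)) integrable_on {a..t}" for j
      by (intro integrable_continuous_real continuous_on_subset[OF comp[OF c] sub])
    have "\<phi> (Suc (Suc i)) t - \<phi> (Suc i) t =
        integral {a..t} (\<lambda>s. F s (\<phi> (Suc i) s) - F s (\<phi> i s))"
      using Henstock_Kurzweil_Integration.integral_diff[OF int[of "Suc i"] int[of i]] \<phi>S[of "Suc i" t] \<phi>S[of i t] by simp
    also have "norm \<dots> \<le> integral {a..t} g"
    proof (rule integral_norm_bound_integral)
      fix s assume "s \<in> {a..t}"
      then have s: "s \<in> {a..b}" using sub by auto
      have "\<bar>F s (\<phi> (Suc i) s) - F s (\<phi> i s)\<bar> \<le> L * \<bar>\<phi> (Suc i) s - \<phi> i s\<bar>"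
        by (rule Lip'[OF s])
      also have "\<dots> \<le> g s" unfolding g_def
        using Suc.IH[OF s] \<open>0 < L\<close> by (intro mult_left_mono) auto
      finally show "norm (F s (\<phi> (Suc i) s) - F s (\<phi> i s)) \<le> g s" by simp
    qed (intro Henstock_Kurzweil_Integration.integrable_diff int g)+
    also have "\<dots> \<le> H t" unfolding g H_def using \<open>0 \<le> M\<close> by simp
    finally show ?case by (simp add: H_def)
  qed
  have step': "norm (\<phi> (Suc i) t - \<phi> i t) \<le> B * (1 / 2) ^ i" if "t \<in> {a..b}" for i t
  proof -
    have "exp (2 * L * (t - a)) \<le> exp (2 * L * (b - a))" using that \<open>0 < L\<close> by simp
    then have "M * (1 / 2) ^ i * exp (2 * L * (t - a)) \<le> M * (1 / 2) ^ i * exp (2 * L * (b - a))"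
      using \<open>0 \<le> M\<close> by (intro mult_left_mono) auto
    then show ?thesis using step[OF that, of i] by (simp add: B_def mult_ac)
  qed
  define \<theta> where "\<theta> t = x0 + (\<Sum>i. \<phi> (Suc i) t - \<phi> i t)" for t
  have "uniform_limit {a..b} (\<lambda>j t. \<Sum>i<j. \<phi> (Suc i) t - \<phi> i t)
      (\<lambda>t. \<Sum>i. \<phi> (Suc i) t - \<phi> i t) sequentially"
    by (rule Weierstrass_m_test[OF step']) (auto intro!: summable_mult summable_geometric)
  then have "uniform_limit {a..b} (\<lambda>j t. x0 + (\<Sum>i<j. \<phi> (Suc i) t - \<phi> i t)) \<theta> sequentially"
    unfolding \<theta>_def by (intro uniform_limit_add uniform_limit_const)
  moreover have "x0 + (\<Sum>i<j. \<phi> (Suc i) t - \<phi> i t) = \<phi> j t" for j t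
    using sum_lessThan_telescope[of "\<lambda>i. \<phi> i t" j] by (simp add: \<phi>0)
  ultimately have lim: "uniform_limit {a..b} \<phi> \<theta> sequentially"
    by simp
  have c\<theta>: "continuous_on {a..b} \<theta>"
    by (rule uniform_limit_theorem[OF _ lim]) (auto simp: c)
  have limF: "uniform_limit {a..b} (\<lambda>i s. F s (\<phi> i s)) (\<lambda>s. F s (\<theta> s)) sequentially"
  proof (rule uniform_limitI)
    fix e :: real assume "0 < e"
    then have "\<forall>\<^sub>F i in sequentially. \<forall>s\<in>{a..b}. dist (\<phi> i s) (\<theta> s) < e / L"
      using uniform_limitD[OF lim, of "e / L"] \<open>0 < L\<close> by auto
    then show "\<forall>\<^sub>F i in sequentially. \<forall>s\<in>{a..b}. dist (F s (\<phi> i s)) (F s (\<theta> s)) < e"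
    proof (eventually_elim, safe)
      fix i s assume H: "\<forall>s\<in>{a..b}. dist (\<phi> i s) (\<theta> s) < e / L" and s: "s \<in> {a..b}"
      have "dist (F s (\<phi> i s)) (F s (\<theta> s)) \<le> L * dist (\<phi> i s) (\<theta> s)"
        unfolding dist_real_def by (rule Lip'[OF s])
      also have "\<dots> < L * (e / L)"
        using H s \<open>0 < L\<close> by (intro mult_strict_left_mono) auto
      finally show "dist (F s (\<phi> i s)) (F s (\<theta> s)) < e" using \<open>0 < L\<close> by simp
    qed
  qed
  have eq: "\<theta> t = x0 + integral {a..t} (\<lambda>s. F s (\<theta> s))" if t: "t \<in> {a..b}" for t
  proof -
    have sub: "{a..t} \<subseteq> {a..b}" using t by auto
    have "(\<lambda>i. integral {a..t} (\<lambda>s. F s (\<phi> i s))) \<longlonglongrightarrow> integral {a..t} (\<lambda>s. F s (\<theta> s))"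
    proof -
      obtain I J where I: "\<And>i. ((\<lambda>s. F s (\<phi> i s)) has_integral I i) {a..t}"
        and J: "((\<lambda>s. F s (\<theta> s)) has_integral J) {a..t}" and "I \<longlonglongrightarrow> J"
        by (rule uniform_limit_integral[OF uniform_limit_on_subset[OF limF sub]])
          (auto intro: continuous_on_subset[OF comp[OF c] sub])
      then show ?thesis by (simp add: integral_unique[OF J] integral_unique[OF I])
    qed
    then have "(\<lambda>i. \<phi> (Suc i) t) \<longlonglongrightarrow> x0 + integral {a..t} (\<lambda>s. F s (\<theta> s))"
      unfolding \<phi>S by (intro tendsto_intros)
    moreover have "(\<lambda>i. \<phi> (Suc i) t) \<longlonglongrightarrow> \<theta> t"
      using tendsto_uniform_limitI[OF lim t] by (rule LIMSEQ_Suc)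
    ultimately show ?thesis by (rule LIMSEQ_unique[symmetric])
  qed
  have "(\<theta> has_real_derivative F t (\<theta> t)) (at t within {a..b})" if t: "t \<in> {a..b}" for t
  proof (rule has_field_derivative_transform_within[OF _ zero_less_one t])
    show "((\<lambda>t. x0 + integral {a..t} (\<lambda>s. F s (\<theta> s))) has_real_derivative F t (\<theta> t))
        (at t within {a..b})"
      by (rule derivative_eq_intros integral_has_real_derivative[OF comp[OF c\<theta>] t] refl)+ simp
  qed (use eq in auto)
  moreover have "\<theta> a = x0" using eq[of a] ab by simp
  ultimately show ?thesis by blast
qed

section \<open>Difference quotients of a C1 function\<close>

definition slope :: "(real \<Rightarrow> real) \<Rightarrow> (real \<Rightarrow> real) \<Rightarrow> real \<Rightarrow> real \<Rightarrow> real" where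
  "slope f f' x y = (if x = y then f' x else (f x - f y) / (x - y))"

lemma slope_eq: "f x - f y = slope f f' x y * (x - y)"
  by (simp add: slope_def)

lemma slope_mvt:
  assumes f: "\<And>x. (f has_real_derivative f' x) (at x)"
  shows "\<exists>\<xi>. min x y \<le> \<xi> \<and> \<xi> \<le> max x y \<and> slope f f' x y = f' \<xi>"
proof (cases "x = y")
  case False
  have *: "\<exists>\<xi>. u < \<xi> \<and> \<xi> < v \<and> (f v - f u) / (v - u) = f' \<xi>" if "u < v" for u v
    using MVT2[OF that, of f f'] f that by auto
  show ?thesis
  proof (cases "x < y")
    case True
    have "(f x - f y) / (x - y) = (f y - f x) / (y - x)"
      by (metis minus_diff_eq minus_divide_divide)
    moreover from * True obtain \<xi> where "x < \<xi>" "\<xi> < y" "(f y - f x) / (y - x) = f' \<xi>"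
      by auto
    ultimately show ?thesis by (intro exI[of _ \<xi>]) (auto simp: slope_def)
  next
    case nless: False
    with False have "y < x" by auto
    then obtain \<xi> where "y < \<xi>" "\<xi> < x" "(f x - f y) / (x - y) = f' \<xi>"
      using * by auto
    then show ?thesis by (intro exI[of _ \<xi>]) (auto simp: slope_def)
  qed
qed (auto simp: slope_def)

text \<open>Near the diagonal the slope is a value of \<open>f'\<close> at an intermediate point.\<close>

lemma continuous_on_slope:
  assumes f: "\<And>x. (f has_real_derivative f' x) (at x)" and f': "continuous_on UNIV f'"
  shows "continuous_on UNIV (\<lambda>z. slope f f' (fst z) (snd z))"
proof -
  have "isCont (\<lambda>z. slope f f' (fst z) (snd z)) (x0, y0)" for x0 y0
  proof (cases "x0 = y0")
    case False
    define U where "U = {z :: real \<times> real. fst z \<noteq> snd z}"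
    have "open U" unfolding U_def by (intro open_Collect_neq continuous_intros)
    have cf: "continuous_on UNIV f" using f by (auto intro: DERIV_continuous_on)
    have "continuous_on U (\<lambda>z. (f (fst z) - f (snd z)) / (fst z - snd z))"
      by (intro continuous_intros continuous_on_compose2[OF cf]) (auto simp: U_def)
    then have "continuous_on U (\<lambda>z. slope f f' (fst z) (snd z))"
      by (rule continuous_on_cong[THEN iffD1, rotated -1]) (auto simp: U_def slope_def)
    then show ?thesis
      using \<open>open U\<close> False by (auto simp: continuous_on_eq_continuous_at U_def)
  next
    case True
    show ?thesis unfolding isCont_def
    proof (rule tendstoI)
      fix e :: real assume "0 < e"
      have "isCont f' x0" using f' by (simp add: continuous_on_eq_continuous_at)
      then obtain d where d: "0 < d" "\<And>u. dist u x0 < d \<Longrightarrow> dist (f' u) (f' x0) < e"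
        using \<open>0 < e\<close> unfolding continuous_at_eps_delta by (metis dist_commute)
      have "\<forall>\<^sub>F z in at (x0, y0). dist z (x0, y0) < d"
        using d by (auto simp: eventually_at)
      then show "\<forall>\<^sub>F z in at (x0, y0). dist (slope f f' (fst z) (snd z))
          (slope f f' (fst (x0, y0)) (snd (x0, y0))) < e"
      proof eventually_elim
        case (elim z)
        have "dist (fst z) x0 < d" "dist (snd z) x0 < d"
          using elim dist_fst_le[of z "(x0, y0)"] dist_snd_le[of z "(x0, y0)"] True by auto
        moreover obtain \<xi> where "min (fst z) (snd z) \<le> \<xi>" "\<xi> \<le> max (fst z) (snd z)"
          and eq: "slope f f' (fst z) (snd z) = f' \<xi>"
          using slope_mvt[of f f' "fst z" "snd z"] f by auto
        ultimately have "dist \<xi> x0 < d"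
          by (auto simp: dist_real_def abs_less_iff min_def max_def split: if_splits)
        then show ?case using d(2)[of \<xi>] True unfolding eq by (simp add: slope_def)
      qed
    qed
  qed
  then show ?thesis by (auto simp: continuous_on_eq_continuous_at)
qed

section \<open>The angle equation\<close>

text \<open>
  The squared positive part of the sine is continuously differentiable although the positive part is not;
  this makes the angle equation smooth in the unknown. The squared negative part is \<open>sin_pos_sq (- x)\<close>.
\<close>

definition sin_pos_sq :: "real \<Rightarrow> real" where
  "sin_pos_sq x = (max (sin x) 0)\<^sup>2"

definition sin_pos_sq' :: "real \<Rightarrow> real" where
  "sin_pos_sq' x = 2 * max (sin x) 0 * cos x"

lemma DERIV_max_0_square: "((\<lambda>y. (max y 0)\<^sup>2) has_real_derivative 2 * max x 0) (at x)" for x :: real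
proof -
  consider "x > 0" | "x < 0" | "x = 0" by linarith
  then show ?thesis
  proof cases
    case 1
    have "((\<lambda>y. y\<^sup>2) has_real_derivative 2 * max x 0) (at x)"
      using 1 by (auto intro!: derivative_eq_intros)
    then show ?thesis
      by (rule has_field_derivative_transform_within_open[of _ _ _ "{0<..}"]) (use 1 in auto)
  next
    case 2
    have "((\<lambda>y. 0) has_real_derivative 2 * max x 0) (at x)"
      using 2 by (auto intro!: derivative_eq_intros)
    then show ?thesis
      by (rule has_field_derivative_transform_within_open[of _ _ _ "{..<0}"]) (use 2 in auto)
  next
    case 3
    have "((\<lambda>h. ((max h 0)\<^sup>2) / h) \<longlongrightarrow> 0) (at (0::real))"
    proof (rule Lim_null_comparison)
      show "\<forall>\<^sub>F h in at 0. norm ((max h 0)\<^sup>2 / h) \<le> \<bar>h :: real\<bar>"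
        by (rule always_eventually) (auto simp: max_def power2_eq_square)
      show "((\<lambda>h. \<bar>h :: real\<bar>) \<longlongrightarrow> 0) (at 0)"
        by (intro tendsto_rabs_zero tendsto_ident_at)
    qed
    then show ?thesis using 3 by (simp add: DERIV_def)
  qed
qed

lemma DERIV_sin_pos_sq: "(sin_pos_sq has_real_derivative sin_pos_sq' x) (at x)"
proof -
  have "((\<lambda>x. (max (sin x) 0)\<^sup>2) has_real_derivative 2 * max (sin x) 0 * cos x) (at x)"
    by (rule DERIV_chain2[OF DERIV_max_0_square DERIV_sin])
  then show ?thesis by (simp add: sin_pos_sq_def[abs_def] sin_pos_sq'_def)
qed

lemma continuous_on_sin_pos_sq: "continuous_on S sin_pos_sq"
  unfolding sin_pos_sq_def by (intro continuous_intros)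

lemma continuous_on_sin_pos_sq': "continuous_on S sin_pos_sq'"
  unfolding sin_pos_sq'_def by (intro continuous_intros)

lemma sin_pos_sq_bounds: "0 \<le> sin_pos_sq x" "sin_pos_sq x \<le> 1"
proof -
  have "(max (sin x) 0)\<^sup>2 \<le> 1\<^sup>2" by (intro power_mono) auto
  then show "0 \<le> sin_pos_sq x" "sin_pos_sq x \<le> 1" by (auto simp: sin_pos_sq_def)
qed

abbreviation sin_slope :: "real \<Rightarrow> real \<Rightarrow> real" where
  "sin_slope \<equiv> slope sin_pos_sq sin_pos_sq'"

lemma sin_slope_bound: "\<bar>sin_slope x y\<bar> \<le> 2"
proof -
  obtain \<xi> where "sin_slope x y = sin_pos_sq' \<xi>"
    using slope_mvt[of sin_pos_sq sin_pos_sq' x y] DERIV_sin_pos_sq by auto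
  moreover have "\<bar>max (sin \<xi>) 0 * cos \<xi>\<bar> \<le> 1 * 1"
    unfolding abs_mult by (intro mult_mono) (auto simp: max_def)
  ultimately show ?thesis by (simp add: sin_pos_sq'_def abs_mult)
qed

locale fucik_problem =
  fixes T1 T2 :: real and p q m n :: "real \<Rightarrow> real"
  assumes T: "T1 < T2"
    and cont_p: "continuous_on {T1..T2} p" and cont_q: "continuous_on {T1..T2} q"
    and cont_m: "continuous_on {T1..T2} m" and cont_n: "continuous_on {T1..T2} n"
    and p_pos: "\<And>t. t \<in> {T1..T2} \<Longrightarrow> 0 < p t" and q_nonneg: "\<And>t. t \<in> {T1..T2} \<Longrightarrow> 0 \<le> q t"
begin

text \<open>
  From \<open>\<theta>' = cos\<^sup>2 \<theta> / p - q sin\<^sup>2 \<theta> + a m (sin\<^sup>+ \<theta>)\<^sup>2 + b n (sin\<^sup>- \<theta>)\<^sup>2\<close>, by writing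
  \<open>cos\<^sup>2 \<theta> = 1 - (sin\<^sup>+ \<theta>)\<^sup>2 - (sin\<^sup>- \<theta>)\<^sup>2\<close>. The parameter pair \<open>(a, b)\<close> is \<open>P\<close>.
\<close>

definition coeff_pos :: "real \<times> real \<Rightarrow> real \<Rightarrow> real" where
  "coeff_pos P t = fst P * m t - q t - 1 / p t"

definition coeff_neg :: "real \<times> real \<Rightarrow> real \<Rightarrow> real" where
  "coeff_neg P t = snd P * n t - q t - 1 / p t"

definition rhs :: "real \<times> real \<Rightarrow> real \<Rightarrow> real \<Rightarrow> real" where
  "rhs P t x = 1 / p t + coeff_pos P t * sin_pos_sq x + coeff_neg P t * sin_pos_sq (- x)"

definition rhs_slope :: "real \<times> real \<Rightarrow> real \<Rightarrow> real \<Rightarrow> real \<Rightarrow> real" where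
  "rhs_slope P t x y = coeff_pos P t * sin_slope x y - coeff_neg P t * sin_slope (- x) (- y)"

lemma rhs_slope: "rhs P t x - rhs P t y = rhs_slope P t x y * (x - y)"
proof -
  have "rhs P t x - rhs P t y = coeff_pos P t * (sin_pos_sq x - sin_pos_sq y)
      + coeff_neg P t * (sin_pos_sq (- x) - sin_pos_sq (- y))"
    by (simp add: rhs_def algebra_simps)
  also have "\<dots> = coeff_pos P t * (sin_slope x y * (x - y))
      + coeff_neg P t * (sin_slope (- x) (- y) * (- x - - y))"
    by (simp only: slope_eq[of sin_pos_sq _ _ sin_pos_sq'])
  finally show ?thesis
    by (simp add: rhs_slope_def algebra_simps)
qed

lemma rhs_int_pi: "rhs P t (of_int j * pi) = 1 / p t"
proof -
  have "sin (of_int j * pi) = 0" by (simp add: sin_zero_iff_int2)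
  then show ?thesis by (simp add: rhs_def sin_pos_sq_def)
qed

lemma continuous_on_coeffs:
  "continuous_on {T1..T2} (coeff_pos P)" "continuous_on {T1..T2} (coeff_neg P)"
  unfolding coeff_pos_def coeff_neg_def
  using p_pos by (force intro!: continuous_intros cont_p cont_q cont_m cont_n)+

lemma continuous_on_coeffs_joint:
  assumes "continuous_on S f" "continuous_on S g" "g ` S \<subseteq> {T1..T2}"
  shows "continuous_on S (\<lambda>z. coeff_pos (f z) (g z))" "continuous_on S (\<lambda>z. coeff_neg (f z) (g z))"
proof -
  have c: "continuous_on S (\<lambda>z. h (g z))" if "continuous_on {T1..T2} h" for h :: "real \<Rightarrow> real"
    by (rule continuous_on_compose2[OF that assms(2,3)])
  have "p (g z) \<noteq> 0" if "z \<in> S" for z using p_pos[of "g z"] assms(3) that by auto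
  then show "continuous_on S (\<lambda>z. coeff_pos (f z) (g z))" "continuous_on S (\<lambda>z. coeff_neg (f z) (g z))"
    unfolding coeff_pos_def coeff_neg_def
    using c[OF cont_p] c[OF cont_q] c[OF cont_m] c[OF cont_n] assms(1)
    by (auto intro!: continuous_intros)
qed

lemma continuous_on_rhs_slope:
  assumes f: "continuous_on S f" and g: "continuous_on S g" "g ` S \<subseteq> {T1..T2}"
    and x: "continuous_on S x" and y: "continuous_on S y"
  shows "continuous_on S (\<lambda>z. rhs_slope (f z) (g z) (x z) (y z))"
proof -
  have sl: "continuous_on S (\<lambda>z. sin_slope (u z) (v z))"
    if "continuous_on S u" "continuous_on S v" for u v
  proof -
    have "continuous_on S (\<lambda>z. (u z, v z))" using that by (intro continuous_intros)
    from continuous_on_compose2[OF continuous_on_slope[OF DERIV_sin_pos_sq continuous_on_sin_pos_sq'] this]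
    show ?thesis by auto
  qed
  show ?thesis
    unfolding rhs_slope_def
    by (intro continuous_intros continuous_on_coeffs_joint[OF f g] sl x y)
qed

lemma continuous_on_rhs: "continuous_on ({T1..T2} \<times> UNIV) (\<lambda>(t, x). rhs P t x)"
proof -
  have 1: "continuous_on ({T1..T2} \<times> UNIV) (\<lambda>z. P)" by simp
  have 2: "continuous_on ({T1..T2} \<times> UNIV) fst" "fst ` ({T1..T2} \<times> UNIV) \<subseteq> {T1..T2}"
    by (auto intro: continuous_on_fst continuous_on_id)
  have "continuous_on ({T1..T2} \<times> UNIV) (\<lambda>z. p (fst z))"
    by (rule continuous_on_compose2[OF cont_p 2])
  moreover have "p (fst z) \<noteq> 0" if "z \<in> {T1..T2} \<times> UNIV" for z :: "real \<times> real"
    using p_pos[of "fst z"] that by auto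
  ultimately have "continuous_on ({T1..T2} \<times> UNIV) (\<lambda>z. rhs P (fst z) (snd z))"
    unfolding rhs_def
    by (intro continuous_intros continuous_on_coeffs_joint[OF 1 2]
        continuous_on_compose2[OF continuous_on_sin_pos_sq[of UNIV]]) auto
  then show ?thesis by (simp add: case_prod_beta)
qed

lemma rhs_slope_bounded:
  obtains K where "\<And>t x y. t \<in> {T1..T2} \<Longrightarrow> \<bar>rhs_slope P t x y\<bar> \<le> K"
proof -
  obtain A B where A: "\<And>t. t \<in> {T1..T2} \<Longrightarrow> \<bar>coeff_pos P t\<bar> \<le> A"
    and B: "\<And>t. t \<in> {T1..T2} \<Longrightarrow> \<bar>coeff_neg P t\<bar> \<le> B"
    using continuous_on_Icc_bounded[OF continuous_on_coeffs(1)]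
      continuous_on_Icc_bounded[OF continuous_on_coeffs(2)] by metis
  have "\<bar>rhs_slope P t x y\<bar> \<le> A * 2 + B * 2" if t: "t \<in> {T1..T2}" for t x y
  proof -
    have "0 \<le> A" "0 \<le> B" using A[OF t] B[OF t] by auto
    then have "\<bar>coeff_pos P t * sin_slope x y\<bar> \<le> A * 2"
      and "\<bar>coeff_neg P t * sin_slope (- x) (- y)\<bar> \<le> B * 2"
      unfolding abs_mult using A[OF t] B[OF t] sin_slope_bound by (auto intro!: mult_mono)
    then show ?thesis unfolding rhs_slope_def by linarith
  qed
  then show ?thesis by (rule that)
qed

definition angle :: "real \<times> real \<Rightarrow> real \<Rightarrow> real" where
  "angle P = (SOME \<theta>. \<theta> T1 = 0 \<and>
     (\<forall>t\<in>{T1..T2}. (\<theta> has_real_derivative rhs P t (\<theta> t)) (at t within {T1..T2})))"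

lemma angle_T1: "angle P T1 = 0"
  and DERIV_angle: "t \<in> {T1..T2} \<Longrightarrow>
    (angle P has_real_derivative rhs P t (angle P t)) (at t within {T1..T2})"
proof -
  obtain K where K: "\<And>t x y. t \<in> {T1..T2} \<Longrightarrow> \<bar>rhs_slope P t x y\<bar> \<le> K"
    using rhs_slope_bounded by blast
  have "\<exists>\<theta>. \<theta> T1 = 0 \<and>
     (\<forall>t\<in>{T1..T2}. (\<theta> has_real_derivative rhs P t (\<theta> t)) (at t within {T1..T2}))"
  proof (rule scalar_ode_exists[OF continuous_on_rhs])
    fix t x y assume "t \<in> {T1..T2}"
    then show "\<bar>rhs P t x - rhs P t y\<bar> \<le> K * \<bar>x - y\<bar>"
      unfolding rhs_slope abs_mult by (intro mult_right_mono K) auto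
  qed (use T in simp)
  from someI_ex[OF this] show "angle P T1 = 0" "t \<in> {T1..T2} \<Longrightarrow>
    (angle P has_real_derivative rhs P t (angle P t)) (at t within {T1..T2})"
    unfolding angle_def[symmetric] by auto
qed

lemma continuous_on_angle: "continuous_on {T1..T2} (angle P)"
  by (rule DERIV_continuous_on[OF DERIV_angle])

section \<open>Dependence of the angle on the parameters\<close>

text \<open>
  The difference of the angles for \<open>P1\<close> and \<open>P2\<close> solves a linear equation exactly, without remainder: its
  coefficient \<open>gap_slope\<close> is a difference quotient of the right-hand side, and its source term is
  linear in \<open>P1 - P2\<close>.
\<close>

definition gap_slope :: "(real \<times> real) \<times> (real \<times> real) \<Rightarrow> real \<Rightarrow> real" where
  "gap_slope z t = rhs_slope (snd z) t (angle (fst z) t) (angle (snd z) t)"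

definition gap_source :: "real \<times> real \<Rightarrow> real \<times> real \<Rightarrow> real \<Rightarrow> real" where
  "gap_source P1 P2 t = (fst P1 - fst P2) * (m t * sin_pos_sq (angle P1 t))
     + (snd P1 - snd P2) * (n t * sin_pos_sq (- angle P1 t))"

lemma continuous_on_gap_slope: "continuous_on {T1..T2} (gap_slope z)"
  unfolding gap_slope_def by (intro continuous_on_rhs_slope continuous_intros continuous_on_angle) auto

lemma continuous_on_gap_source: "continuous_on {T1..T2} (gap_source P1 P2)"
  unfolding gap_source_def
  by (intro continuous_intros cont_m cont_n continuous_on_angle
      continuous_on_compose2[OF continuous_on_sin_pos_sq[of UNIV]]) auto

lemma DERIV_angle_gap:
  assumes t: "t \<in> {T1..T2}"
  shows "((\<lambda>t. angle P1 t - angle P2 t) has_real_derivative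
    gap_slope (P1, P2) t * (angle P1 t - angle P2 t) + gap_source P1 P2 t) (at t within {T1..T2})"
proof (rule DERIV_cong)
  show "((\<lambda>t. angle P1 t - angle P2 t) has_real_derivative
      rhs P1 t (angle P1 t) - rhs P2 t (angle P2 t)) (at t within {T1..T2})"
    by (intro derivative_intros DERIV_angle t)
  have "rhs P1 t x = rhs P2 t x + (fst P1 - fst P2) * (m t * sin_pos_sq x)
     + (snd P1 - snd P2) * (n t * sin_pos_sq (- x))" for x
    by (simp add: rhs_def coeff_pos_def coeff_neg_def algebra_simps)
  then show "rhs P1 t (angle P1 t) - rhs P2 t (angle P2 t) =
      gap_slope (P1, P2) t * (angle P1 t - angle P2 t) + gap_source P1 P2 t"
    using rhs_slope[of P2 t "angle P1 t" "angle P2 t"] by (simp add: gap_slope_def gap_source_def)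
qed

text \<open>
  The angle is continuous in \<open>t\<close>, and Lipschitz in the parameters at each \<open>P0\<close> with a constant that is
  uniform in \<open>t\<close>.
\<close>

lemma continuous_on_angle_joint: "continuous_on (UNIV \<times> {T1..T2}) (\<lambda>(P, t). angle P t)"
proof -
  obtain M where M: "0 \<le> M" "\<And>t. t \<in> {T1..T2} \<Longrightarrow> \<bar>m t\<bar> \<le> M" "\<And>t. t \<in> {T1..T2} \<Longrightarrow> \<bar>n t\<bar> \<le> M"
  proof -
    obtain A B where "\<And>t. t \<in> {T1..T2} \<Longrightarrow> \<bar>m t\<bar> \<le> A" "\<And>t. t \<in> {T1..T2} \<Longrightarrow> \<bar>n t\<bar> \<le> B"
      using continuous_on_Icc_bounded[OF cont_m] continuous_on_Icc_bounded[OF cont_n] by metis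
    then show ?thesis using that[of "max 0 (max A B)"] by (fastforce simp: le_max_iff_disj)
  qed
  have Lip: "\<exists>C\<ge>0. \<forall>P. \<forall>t\<in>{T1..T2}. \<bar>angle P t - angle P0 t\<bar> \<le> C * dist P P0" for P0
  proof -
    obtain K where K: "\<And>t x y. t \<in> {T1..T2} \<Longrightarrow> \<bar>rhs_slope P0 t x y\<bar> \<le> K"
      using rhs_slope_bounded by blast
    define C where "C = exp (2 * K * (T2 - T1)) * (T2 - T1) * (2 * M)"
    have "0 \<le> C" using T M by (simp add: C_def)
    moreover have "\<bar>angle P t - angle P0 t\<bar> \<le> C * dist P P0" if t: "t \<in> {T1..T2}" for P t
    proof -
      have src: "\<bar>gap_source P P0 t\<bar> \<le> 2 * M * dist P P0" if t: "t \<in> {T1..T2}" for t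
      proof -
        have "\<bar>fst P - fst P0\<bar> * (\<bar>m t\<bar> * \<bar>sin_pos_sq (angle P t)\<bar>) \<le> dist P P0 * (M * 1)"
          using dist_fst_le[of P P0] M sin_pos_sq_bounds t
          by (intro mult_mono) (auto simp: dist_real_def)
        moreover have "\<bar>snd P - snd P0\<bar> * (\<bar>n t\<bar> * \<bar>sin_pos_sq (- angle P t)\<bar>) \<le> dist P P0 * (M * 1)"
          using dist_snd_le[of P P0] M sin_pos_sq_bounds t
          by (intro mult_mono) (auto simp: dist_real_def)
        moreover have "\<bar>gap_source P P0 t\<bar> \<le>
            \<bar>fst P - fst P0\<bar> * (\<bar>m t\<bar> * \<bar>sin_pos_sq (angle P t)\<bar>) +
            \<bar>snd P - snd P0\<bar> * (\<bar>n t\<bar> * \<bar>sin_pos_sq (- angle P t)\<bar>)"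
          unfolding gap_source_def abs_mult[symmetric] by (rule abs_triangle_ineq)
        moreover have "2 * M * dist P P0 = dist P P0 * (M * 1) + dist P P0 * (M * 1)" by simp
        ultimately show ?thesis by linarith
      qed
      have "\<bar>angle P t - angle P0 t\<bar> \<le> exp (2 * K * (T2 - T1)) * (T2 - T1) * (2 * M * dist P P0)"
        by (rule linear_ode_bound[OF continuous_on_gap_slope continuous_on_gap_source
              DERIV_angle_gap t]) (use K src in \<open>auto simp: gap_slope_def angle_T1\<close>)
      then show ?thesis by (simp add: C_def mult_ac)
    qed
    ultimately show ?thesis by blast
  qed
  show ?thesis
    unfolding continuous_on_iff
  proof (intro ballI allI impI)
    fix y :: "(real \<times> real) \<times> real" and e :: real
    assume "y \<in> UNIV \<times> {T1..T2}" "0 < e"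
    then obtain P0 t0 where y: "y = (P0, t0)" and t0: "T1 \<le> t0" "t0 \<le> T2" by auto
    obtain C where C: "0 \<le> C" "\<And>P t. t \<in> {T1..T2} \<Longrightarrow> \<bar>angle P t - angle P0 t\<bar> \<le> C * dist P P0"
      using Lip[of P0] by auto
    obtain d where d: "0 < d" "\<And>t. t \<in> {T1..T2} \<Longrightarrow> dist t t0 < d \<Longrightarrow>
        dist (angle P0 t) (angle P0 t0) < e / 2"
      using continuous_on_angle[of P0] t0 \<open>0 < e\<close> unfolding continuous_on_iff
      by (metis atLeastAtMost_iff half_gt_zero)
    define d' where "d' = min d (e / (2 * (C + 1)))"
    have "0 < d'" using d \<open>0 < e\<close> C by (auto simp: d'_def)
    moreover have "dist (angle P t) (angle P0 t0) < e"
      if t: "T1 \<le> t" "t \<le> T2" and close: "dist (P, t) (P0, t0) < d'" for P t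
    proof -
      have "dist P P0 < d'" "dist t t0 < d'"
        using close dist_fst_le[of "(P, t)" "(P0, t0)"] dist_snd_le[of "(P, t)" "(P0, t0)"] by auto
      then have "dist t t0 < d" "dist P P0 * (C + 1) < e / 2"
        using C by (auto simp: d'_def field_simps)
      moreover have "C * dist P P0 \<le> dist P P0 * (C + 1)" by (simp add: algebra_simps)
      moreover have "dist (angle P0 t) (angle P0 t0) < e / 2"
        using d(2)[of t] t \<open>dist t t0 < d\<close> by auto
      moreover have "dist (angle P t) (angle P0 t) \<le> C * dist P P0"
        using C(2)[of t P] t by (auto simp: dist_real_def)
      moreover have "dist (angle P t) (angle P0 t0)
          \<le> dist (angle P t) (angle P0 t) + dist (angle P0 t) (angle P0 t0)"
        by (rule dist_triangle)
      ultimately show ?thesis by linarith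
    qed
    ultimately show "\<exists>d>0. \<forall>x\<in>UNIV \<times> {T1..T2}. dist x y < d \<longrightarrow>
        dist (case x of (P, t) \<Rightarrow> angle P t) (case y of (P, t) \<Rightarrow> angle P t) < e"
      unfolding y by (intro exI[of _ d']) auto
  qed
qed

lemma continuous_on_angle_compose:
  assumes "continuous_on S f" "continuous_on S g" "g ` S \<subseteq> {T1..T2}"
  shows "continuous_on S (\<lambda>z. angle (f z) (g z))"
proof -
  have "continuous_on S (\<lambda>z. (f z, g z))" using assms by (intro continuous_intros)
  from continuous_on_compose2[OF continuous_on_angle_joint this] show ?thesis
    using assms(3) by (auto simp: image_subset_iff)
qed

definition gap_exponent :: "(real \<times> real) \<times> (real \<times> real) \<Rightarrow> real \<Rightarrow> real" where
  "gap_exponent z t = integral {T1..t} (gap_slope z)"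

lemma continuous_on_gap_exponent: "continuous_on (UNIV \<times> {T1..T2}) (\<lambda>(z, t). gap_exponent z t)"
proof -
  have "continuous_on (UNIV \<times> {T1..T2}) (\<lambda>y. gap_slope (fst y) (snd y))"
    unfolding gap_slope_def
    by (intro continuous_on_rhs_slope continuous_intros continuous_on_angle_compose) auto
  then show ?thesis
    unfolding gap_exponent_def by (intro continuous_on_integral_Icc) (simp add: case_prod_beta)
qed

text \<open>
  The coefficients of the exact difference formula. At a pair \<open>(P, P)\<close> they are the partial derivatives of the
  final angle with respect to \<open>a\<close> and \<open>b\<close>.
\<close>

definition sens_a :: "(real \<times> real) \<times> (real \<times> real) \<Rightarrow> real" where
  "sens_a z = exp (gap_exponent z T2) *
     integral {T1..T2} (\<lambda>s. exp (- gap_exponent z s) * (m s * sin_pos_sq (angle (fst z) s)))"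

definition sens_b :: "(real \<times> real) \<times> (real \<times> real) \<Rightarrow> real" where
  "sens_b z = exp (gap_exponent z T2) *
     integral {T1..T2} (\<lambda>s. exp (- gap_exponent z s) * (n s * sin_pos_sq (- angle (fst z) s)))"

lemma continuous_on_sens_integral:
  assumes h: "continuous_on {T1..T2} h" and \<phi>: "continuous_on UNIV \<phi>"
  shows "continuous_on UNIV (\<lambda>z. exp (gap_exponent z T2) *
     integral {T1..T2} (\<lambda>s. exp (- gap_exponent z s) * (h s * \<phi> (angle (fst z) s :: real))))"
proof -
  have E: "continuous_on (UNIV \<times> {T1..T2}) (\<lambda>y. gap_exponent (fst y) (snd y))"
    using continuous_on_gap_exponent by (simp add: case_prod_beta)
  have "continuous_on UNIV (\<lambda>z. (z, T2))" by (intro continuous_intros)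
  from continuous_on_compose2[OF E this] have 1: "continuous_on UNIV (\<lambda>z. gap_exponent z T2)"
    using T by (auto simp: image_subset_iff)
  have "continuous_on (UNIV \<times> {T1..T2}) (\<lambda>y. exp (- gap_exponent (fst y) (snd y)) *
      (h (snd y) * \<phi> (angle (fst (fst y)) (snd y))))"
    by (intro continuous_intros E continuous_on_compose2[OF h] continuous_on_compose2[OF \<phi>]
        continuous_on_angle_compose) auto
  then have "continuous_on (UNIV \<times> cbox T1 T2) (\<lambda>(z, s). exp (- gap_exponent z s) *
      (h s * \<phi> (angle (fst z) s)))"
    by (simp add: case_prod_beta)
  from integral_continuous_on_param[OF this] have 2: "continuous_on UNIV
     (\<lambda>z. integral {T1..T2} (\<lambda>s. exp (- gap_exponent z s) * (h s * \<phi> (angle (fst z) s))))"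
    by simp
  show ?thesis by (intro continuous_intros 1 2)
qed

lemma continuous_on_sens_a: "continuous_on UNIV sens_a"
  unfolding sens_a_def[abs_def]
  by (rule continuous_on_sens_integral[OF cont_m continuous_on_sin_pos_sq])

lemma continuous_on_sens_b: "continuous_on UNIV sens_b"
  unfolding sens_b_def[abs_def]
  by (rule continuous_on_sens_integral[OF cont_n]) 
    (intro continuous_on_compose2[OF continuous_on_sin_pos_sq[of UNIV]] continuous_intros, auto)

lemma angle_T2_difference:
  "angle P1 T2 - angle P2 T2 =
    (fst P1 - fst P2) * sens_a (P1, P2) + (snd P1 - snd P2) * sens_b (P1, P2)"
proof -
  define f where "f s = exp (- gap_exponent (P1, P2) s) * (m s * sin_pos_sq (angle P1 s))" for s
  define g where "g s = exp (- gap_exponent (P1, P2) s) * (n s * sin_pos_sq (- angle P1 s))" for s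
  have E: "continuous_on {T1..T2} (gap_exponent (P1, P2))"
    unfolding gap_exponent_def
    by (rule DERIV_continuous_on[OF integral_has_real_derivative[OF continuous_on_gap_slope]])
  have f: "f integrable_on {T1..T2}" and g: "g integrable_on {T1..T2}"
    unfolding f_def g_def
    by (intro integrable_continuous_real continuous_intros E cont_m cont_n continuous_on_angle
        continuous_on_compose2[OF continuous_on_sin_pos_sq[of UNIV]]; simp)+
  have "angle P1 T2 - angle P2 T2 = exp (gap_exponent (P1, P2) T2) *
    integral {T1..T2} (\<lambda>s. exp (- gap_exponent (P1, P2) s) * gap_source P1 P2 s)"
    using linear_ode_solution[OF continuous_on_gap_slope continuous_on_gap_source
        DERIV_angle_gap, where t = T2] T
    by (simp add: gap_exponent_def angle_T1)
  also have "(\<lambda>s. exp (- gap_exponent (P1, P2) s) * gap_source P1 P2 s) =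
      (\<lambda>s. (fst P1 - fst P2) * f s + (snd P1 - snd P2) * g s)"
    by (auto simp: f_def g_def gap_source_def algebra_simps)
  also have "integral {T1..T2} \<dots> =
      (fst P1 - fst P2) * integral {T1..T2} f + (snd P1 - snd P2) * integral {T1..T2} g"
    using f g by (subst Henstock_Kurzweil_Integration.integral_add)
      (auto intro!: integrable_on_mult_right)
  finally show ?thesis
    unfolding sens_a_def sens_b_def f_def g_def by (simp add: algebra_simps)
qed

section \<open>Oscillation of the angle\<close>

text \<open>Where the angle is a multiple of \<open>\<pi>\<close>, its derivative is \<open>1 / p\<close>, whatever the parameters.\<close>

lemma angle_crosses_upwards:
  assumes "s < t" "s \<in> {T1..T2}" "t \<in> {T1..T2}" "of_int j * pi \<le> angle P s"
  shows "of_int j * pi < angle P t"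
proof -
  have sub: "{s..t} \<subseteq> {T1..T2}" using assms by auto
  have "0 < angle P t - of_int j * pi"
  proof (rule upcrossing_pos[of s t "\<lambda>t. angle P t - of_int j * pi"])
    show "continuous_on {s..t} (\<lambda>t. angle P t - of_int j * pi)"
      by (intro continuous_intros continuous_on_subset[OF continuous_on_angle sub])
    fix z assume z: "z \<in> {s..t}" "angle P z - of_int j * pi = 0"
    have "((\<lambda>t. angle P t - of_int j * pi) has_real_derivative 1 / p z) (at z within {s..t})"
      using has_field_derivative_subset[OF DERIV_angle sub, of z P] z sub rhs_int_pi[of P z j]
      by (auto intro!: derivative_eq_intros)
    then show "\<exists>d>0. ((\<lambda>t. angle P t - of_int j * pi) has_real_derivative d) (at z within {s..t})"
      using p_pos[of z] z sub by (intro exI[of _ "1 / p z"]) auto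
  qed (use assms in auto)
  then show ?thesis by simp
qed

lemma angle_pos: "T1 < t \<Longrightarrow> t \<le> T2 \<Longrightarrow> 0 < angle P t"
  using angle_crosses_upwards[of T1 t 0 P] by (simp add: angle_T1)

lemma angle_attains:
  assumes "s \<le> t" "s \<in> {T1..T2}" "t \<in> {T1..T2}" "angle P s \<le> c" "c \<le> angle P t"
  shows "\<exists>z. s \<le> z \<and> z \<le> t \<and> angle P z = c"
proof -
  have "continuous_on {s..t} (angle P)"
    by (rule continuous_on_subset[OF continuous_on_angle]) (use assms in auto)
  then show ?thesis using IVT'[of "angle P" s c t] assms by auto
qed

end

section \<open>First-order form of the boundary value problem\<close>

lemma dirichlet_solutionI:
  assumes T: "T1 < T2" and p: "continuous_on {T1..T2} p" "\<And>t. t \<in> {T1..T2} \<Longrightarrow> 0 < p t"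
    and q: "continuous_on {T1..T2} q" and g: "continuous_on {T1..T2} g"
    and u: "\<And>t. t \<in> {T1..T2} \<Longrightarrow> (u has_real_derivative v t / p t) (at t within {T1..T2})"
    and v: "\<And>t. t \<in> {T1..T2} \<Longrightarrow> (v has_real_derivative q t * u t - g t) (at t within {T1..T2})"
    and bc: "u T1 = 0" "u T2 = 0"
  shows "dirichlet_solution T1 T2 p q g u" and "D T1 T2 u T1 = v T1 / p T1"
proof -
  have Du: "D T1 T2 u t = v t / p t" if "t \<in> {T1..T2}" for t
    unfolding D_def using u[OF that] T that
    by (intro vector_derivative_within_closed_interval)
      (auto simp: has_real_derivative_iff_has_vector_derivative)
  have pDu: "p t * D T1 T2 u t = v t" if "t \<in> {T1..T2}" for t
    using Du[OF that] p(2)[OF that] by simp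
  have v': "((\<lambda>t. p t * D T1 T2 u t) has_real_derivative q t * u t - g t) (at t within {T1..T2})"
    if "t \<in> {T1..T2}" for t
    by (rule has_field_derivative_transform_within[OF v[OF that] zero_less_one that]) (simp add: pDu)
  have Dv: "D T1 T2 (\<lambda>t. p t * D T1 T2 u t) t = q t * u t - g t" if "t \<in> {T1..T2}" for t
    unfolding D_def[of T1 T2 "\<lambda>t. p t * D T1 T2 u t"] using v'[OF that] T that
    by (intro vector_derivative_within_closed_interval)
      (auto simp: has_real_derivative_iff_has_vector_derivative)
  have cu: "continuous_on {T1..T2} u" and cv: "continuous_on {T1..T2} v"
    by (rule DERIV_continuous_on[OF u] DERIV_continuous_on[OF v], assumption)+
  have "continuous_on {T1..T2} (\<lambda>t. v t / p t)"
    using p(2) by (force intro!: continuous_intros cv p(1))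
  then have "continuous_on {T1..T2} (D T1 T2 u)"
    by (rule continuous_on_cong[THEN iffD1, rotated -1]) (auto simp: Du)
  moreover have "continuous_on {T1..T2} (\<lambda>t. q t * u t - g t)"
    by (intro continuous_intros q g cu)
  then have "continuous_on {T1..T2} (D T1 T2 (\<lambda>t. p t * D T1 T2 u t))"
    by (rule continuous_on_cong[THEN iffD1, rotated -1]) (auto simp: Dv)
  moreover have "u differentiable_on {T1..T2}" "(\<lambda>t. p t * D T1 T2 u t) differentiable_on {T1..T2}"
    unfolding differentiable_on_def real_differentiable_def using u v' by blast+
  ultimately show "dirichlet_solution T1 T2 p q g u"
    using bc by (auto simp: dirichlet_solution_def C1_Icc_def L_def Dv)
  show "D T1 T2 u T1 = v T1 / p T1"
    using Du[of T1] T by auto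
qed

lemma dirichlet_solutionD:
  assumes sol: "dirichlet_solution T1 T2 p q g u" and p: "\<forall>t\<in>{T1..T2}. 0 < p t"
  defines "v \<equiv> \<lambda>t. p t * D T1 T2 u t"
  shows "continuous_on {T1..T2} u" "continuous_on {T1..T2} v"
    and "\<And>t. t \<in> {T1<..<T2} \<Longrightarrow> (u has_real_derivative v t / p t) (at t)"
    and "\<And>t. t \<in> {T1<..<T2} \<Longrightarrow> (v has_real_derivative q t * u t - g t) (at t)"
    and "u T1 = 0" "u T2 = 0"
proof -
  have der: "(w has_real_derivative D T1 T2 w t) (at t)"
    if "w differentiable_on {T1..T2}" "t \<in> {T1<..<T2}" for w t
  proof -
    have "w differentiable (at t within {T1..T2})"
      using that by (auto simp: differentiable_on_def)
    then have "(w has_vector_derivative D T1 T2 w t) (at t within {T1..T2})"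
      by (simp add: D_def vector_derivative_works[symmetric])
    then show ?thesis
      using that(2) by (simp add: at_within_Icc_at has_real_derivative_iff_has_vector_derivative)
  qed
  have du: "u differentiable_on {T1..T2}" and dv: "v differentiable_on {T1..T2}"
    using sol by (auto simp: dirichlet_solution_def C1_Icc_def v_def)
  then show "continuous_on {T1..T2} u" "continuous_on {T1..T2} v"
    by (auto intro: differentiable_imp_continuous_on)
  fix t assume t: "t \<in> {T1<..<T2}"
  have "D T1 T2 u t = v t / p t" using bspec[OF p, of t] t by (simp add: v_def)
  then show "(u has_real_derivative v t / p t) (at t)" using der[OF du t] by simp
  have "L T1 T2 p q u t = g t" using sol t by (simp add: dirichlet_solution_def)
  then have "D T1 T2 v t = q t * u t - g t" unfolding L_def v_def by simp
  then show "(v has_real_derivative q t * u t - g t) (at t)" using der[OF dv t] by simp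
next
  show "u T1 = 0" "u T2 = 0" using sol by (auto simp: dirichlet_solution_def)
qed

context fucik_problem
begin

lemma p_pos_ball: "\<forall>t\<in>{T1..T2}. 0 < p t"
  using p_pos by blast

text \<open>
  The equation is required in the open interval only, as in the definition of a solution; continuity at
  the ends suffices for uniqueness.
\<close>

definition solves :: "real \<times> real \<Rightarrow> (real \<Rightarrow> real) \<Rightarrow> (real \<Rightarrow> real) \<Rightarrow> bool" where
  "solves P u v \<longleftrightarrow> continuous_on {T1..T2} u \<and> continuous_on {T1..T2} v \<and> u T1 = 0 \<and>
     (\<forall>t\<in>{T1<..<T2}. (u has_real_derivative v t / p t) (at t) \<and>
        (v has_real_derivative
          q t * u t - (fst P * m t * pos_part u t - snd P * n t * neg_part u t)) (at t))"

text \<open>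
  Gronwall: positive and negative part are 1-Lipschitz, so the squared distance of two solutions, multiplied by
  \<open>exp (- K * t)\<close>, decreases.
\<close>

lemma solves_unique:
  assumes u: "solves P u v" and w: "solves P w z" and init: "v T1 = z T1" and t: "t \<in> {T1..T2}"
  shows "u t = w t" "v t = z t"
proof -
  have "continuous_on {T1..T2} (\<lambda>t. 1 / p t + q t + \<bar>fst P * m t\<bar> + \<bar>snd P * n t\<bar>)"
    using p_pos by (force intro!: continuous_intros cont_p cont_q cont_m cont_n)
  from continuous_on_Icc_bounded[OF this] obtain K where "\<And>t. t \<in> {T1..T2} \<Longrightarrow>
      \<bar>1 / p t + q t + \<bar>fst P * m t\<bar> + \<bar>snd P * n t\<bar>\<bar> \<le> K"
    by blast
  then have K: "1 / p t + q t + \<bar>fst P * m t\<bar> + \<bar>snd P * n t\<bar> \<le> K" if "t \<in> {T1..T2}" for t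
    using that abs_le_D1 by blast
  define E where "E t = ((u t - w t)\<^sup>2 + (v t - z t)\<^sup>2) * exp (- K * t)" for t
  have "E t \<le> E T1"
  proof (rule DERIV_nonpos_imp_decreasing_open[of T1 t E])
    have "continuous_on {T1..T2} E"
      unfolding E_def using u w by (intro continuous_intros) (auto simp: solves_def)
    then show "continuous_on {T1..t} E"
      by (rule continuous_on_subset) (use t in auto)
    fix s assume s: "T1 < s" "s < t"
    then have s': "s \<in> {T1<..<T2}" "s \<in> {T1..T2}" using t by auto
    define d where "d = u s - w s"
    define e where "e = v s - z s"
    define f where "f = q s * d - fst P * m s * (pos_part u s - pos_part w s)
        + snd P * n s * (neg_part u s - neg_part w s)"
    have "(E has_real_derivative (2 * d * (e / p s) + 2 * e * f) * exp (- K * s)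
        + (d\<^sup>2 + e\<^sup>2) * (exp (- K * s) * (- K))) (at s)"
    proof -
      have du: "(u has_real_derivative v s / p s) (at s)" "(w has_real_derivative z s / p s) (at s)"
        using u w s' by (auto simp: solves_def)
      have dv: "(v has_real_derivative
          q s * u s - (fst P * m s * pos_part u s - snd P * n s * neg_part u s)) (at s)"
        "(z has_real_derivative
          q s * w s - (fst P * m s * pos_part w s - snd P * n s * neg_part w s)) (at s)"
        using u w s' by (auto simp: solves_def)
      have de: "((\<lambda>t. u t - w t) has_real_derivative e / p s) (at s)"
        "((\<lambda>t. v t - z t) has_real_derivative f) (at s)"
        using DERIV_diff[OF du] DERIV_diff[OF dv]
        by (auto simp: e_def d_def f_def diff_divide_distrib algebra_simps)
      have sq: "((\<lambda>t. (u t - w t)\<^sup>2 + (v t - z t)\<^sup>2) has_real_derivative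
          2 * d * (e / p s) + 2 * e * f) (at s)"
        by (rule DERIV_cong[OF DERIV_add[OF DERIV_power[OF de(1), of 2] DERIV_power[OF de(2), of 2]]])
          (simp add: d_def[symmetric] e_def[symmetric])
      have ex: "((\<lambda>t. exp (- K * t)) has_real_derivative exp (- K * s) * (- K)) (at s)"
        by (auto intro!: derivative_eq_intros)
      show ?thesis unfolding E_def
        by (rule DERIV_cong[OF DERIV_mult[OF sq ex]]) (simp add: d_def e_def)
    qed
    moreover have "2 * d * (e / p s) + 2 * e * f \<le> (d\<^sup>2 + e\<^sup>2) * K"
    proof -
      have "\<bar>pos_part u s - pos_part w s\<bar> \<le> \<bar>d\<bar>" "\<bar>neg_part u s - neg_part w s\<bar> \<le> \<bar>d\<bar>"
        by (auto simp: pos_part_def neg_part_def d_def max_def)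
      then have "\<bar>fst P * m s\<bar> * \<bar>pos_part u s - pos_part w s\<bar> \<le> \<bar>fst P * m s\<bar> * \<bar>d\<bar>"
        and "\<bar>snd P * n s\<bar> * \<bar>neg_part u s - neg_part w s\<bar> \<le> \<bar>snd P * n s\<bar> * \<bar>d\<bar>"
        by (intro mult_left_mono; simp)+
      moreover have "\<bar>f\<bar> \<le> \<bar>q s * d\<bar> + \<bar>fst P * m s * (pos_part u s - pos_part w s)\<bar>
          + \<bar>snd P * n s * (neg_part u s - neg_part w s)\<bar>"
        unfolding f_def by linarith
      moreover have "\<bar>q s * d\<bar> = q s * \<bar>d\<bar>" using q_nonneg s' by (simp add: abs_mult)
      ultimately have "\<bar>f\<bar> \<le> (q s + \<bar>fst P * m s\<bar> + \<bar>snd P * n s\<bar>) * \<bar>d\<bar>"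
        unfolding abs_mult[of "_ * _" "_ - _"] by (simp add: distrib_right)
      then have "\<bar>e\<bar> * \<bar>f\<bar> \<le> \<bar>e\<bar> * ((q s + \<bar>fst P * m s\<bar> + \<bar>snd P * n s\<bar>) * \<bar>d\<bar>)"
        by (intro mult_left_mono) auto
      moreover have "d * (e / p s) \<le> \<bar>d\<bar> * \<bar>e\<bar> * (1 / p s)"
        using p_pos[OF s'(2)] abs_ge_self[of "d * e"]
        by (simp add: divide_right_mono abs_mult)
      moreover have "e * f \<le> \<bar>e\<bar> * \<bar>f\<bar>"
        by (metis abs_ge_self abs_mult)
      ultimately have "d * (e / p s) + e * f
          \<le> \<bar>d\<bar> * \<bar>e\<bar> * (1 / p s + q s + \<bar>fst P * m s\<bar> + \<bar>snd P * n s\<bar>)"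
        by (simp add: algebra_simps)
      also have "\<dots> \<le> \<bar>d\<bar> * \<bar>e\<bar> * K"
        using K[OF s'(2)] by (intro mult_left_mono) auto
      finally have 1: "2 * d * (e / p s) + 2 * e * f \<le> 2 * \<bar>d\<bar> * \<bar>e\<bar> * K" by simp
      have "0 \<le> K"
      proof -
        have "0 < 1 / p s" using p_pos[OF s'(2)] by simp
        then show ?thesis using K[OF s'(2)] q_nonneg[OF s'(2)] by linarith
      qed
      moreover have "2 * \<bar>d\<bar> * \<bar>e\<bar> \<le> d\<^sup>2 + e\<^sup>2"
        using sum_squares_bound[of "\<bar>d\<bar>" "\<bar>e\<bar>"] by simp
      ultimately have "2 * \<bar>d\<bar> * \<bar>e\<bar> * K \<le> (d\<^sup>2 + e\<^sup>2) * K"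
        by (intro mult_right_mono)
      with 1 show ?thesis by (rule order_trans)
    qed
    then have *: "(2 * d * (e / p s) + 2 * e * f) * exp (- K * s) \<le> (d\<^sup>2 + e\<^sup>2) * K * exp (- K * s)"
      by (rule mult_right_mono) simp
    have "(2 * d * (e / p s) + 2 * e * f) * exp (- K * s)
        + (d\<^sup>2 + e\<^sup>2) * (exp (- K * s) * (- K)) \<le> 0"
    proof -
      have "(d\<^sup>2 + e\<^sup>2) * (exp (- K * s) * (- K)) = - ((d\<^sup>2 + e\<^sup>2) * K * exp (- K * s))" by simp
      with * show ?thesis by linarith
    qed
    ultimately show "\<exists>y. (E has_real_derivative y) (at s) \<and> y \<le> 0" by blast
  qed (use t in auto)
  also have "E T1 = 0" using u w init by (simp add: E_def solves_def)
  finally have "(u t - w t)\<^sup>2 + (v t - z t)\<^sup>2 \<le> 0"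
    by (simp add: E_def mult_le_0_iff)
  then have "(u t - w t)\<^sup>2 + (v t - z t)\<^sup>2 = 0"
    by (intro antisym) auto
  then show "u t = w t" "v t = z t"
    unfolding sum_power2_eq_zero_iff by auto
qed

section \<open>Polar coordinates\<close>

text \<open>
  The logarithmic derivative of the radius is minus one half of the derivative of the right-hand side of the
  angle equation in the angle. Hence \<open>radius\<^sup>2\<close> is the integrating factor of the linearised
  angle equation, see \<open>exp_gap_exponent_diag\<close>.
\<close>

definition log_radius' :: "real \<times> real \<Rightarrow> real \<Rightarrow> real" where
  "log_radius' P t = (coeff_neg P t * max (- sin (angle P t)) 0
     - coeff_pos P t * max (sin (angle P t)) 0) * cos (angle P t)"

definition radius :: "real \<times> real \<Rightarrow> real \<Rightarrow> real" where
  "radius P t = exp (integral {T1..t} (log_radius' P))"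

definition sol :: "real \<times> real \<Rightarrow> real \<Rightarrow> real" where
  "sol P t = radius P t * sin (angle P t)"

definition flux :: "real \<times> real \<Rightarrow> real \<Rightarrow> real" where
  "flux P t = radius P t * cos (angle P t)"

lemma radius_pos: "0 < radius P t"
  by (simp add: radius_def)

lemma continuous_on_log_radius': "continuous_on {T1..T2} (log_radius' P)"
  unfolding log_radius'_def by (intro continuous_intros continuous_on_coeffs continuous_on_angle)

lemma DERIV_radius:
  assumes t: "t \<in> {T1..T2}"
  shows "(radius P has_real_derivative radius P t * log_radius' P t) (at t within {T1..T2})"
  unfolding radius_def
  by (rule derivative_eq_intros integral_has_real_derivative[OF continuous_on_log_radius' t] refl)+

lemma DERIV_sol:
  assumes t: "t \<in> {T1..T2}"
  shows "(sol P has_real_derivative flux P t / p t) (at t within {T1..T2})"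
proof -
  define s where "s = sin (angle P t)"
  define c where "c = cos (angle P t)"
  define x where "x = max s 0"
  define y where "y = max (- s) 0"
  have xy: "x * s = x\<^sup>2" "y * s = - y\<^sup>2"
    by (auto simp: x_def y_def max_def power2_eq_square)
  have "(sol P has_real_derivative radius P t * log_radius' P t * s
      + c * rhs P t (angle P t) * radius P t) (at t within {T1..T2})"
    unfolding sol_def s_def c_def
    by (rule derivative_eq_intros DERIV_radius DERIV_angle t refl)+
  moreover have "log_radius' P t * s + c * rhs P t (angle P t) = c / p t"
  proof -
    have "log_radius' P t * s = (coeff_neg P t * (y * s) - coeff_pos P t * (x * s)) * c"
      by (simp add: log_radius'_def s_def[symmetric] c_def[symmetric] x_def y_def algebra_simps)
    moreover have "c * rhs P t (angle P t) = c * (1 / p t + coeff_pos P t * x\<^sup>2 + coeff_neg P t * y\<^sup>2)"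
      by (simp add: rhs_def sin_pos_sq_def x_def y_def s_def)
    ultimately show ?thesis unfolding xy by (simp add: algebra_simps)
  qed
  then have "radius P t * (log_radius' P t * s + c * rhs P t (angle P t)) = flux P t / p t"
    by (simp add: flux_def c_def)
  then have "radius P t * log_radius' P t * s + c * rhs P t (angle P t) * radius P t = flux P t / p t"
    by (simp add: algebra_simps)
  ultimately show ?thesis by simp
qed

lemma DERIV_flux:
  assumes t: "t \<in> {T1..T2}"
  shows "(flux P has_real_derivative
    q t * sol P t - (fst P * m t * pos_part (sol P) t - snd P * n t * neg_part (sol P) t))
    (at t within {T1..T2})"
proof -
  define s where "s = sin (angle P t)"
  define c where "c = cos (angle P t)"
  define x where "x = max s 0"
  define y where "y = max (- s) 0"
  have xy: "x * s = x\<^sup>2" "y * s = - y\<^sup>2" "s = x - y"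
    by (auto simp: x_def y_def max_def power2_eq_square)
  have sc: "c\<^sup>2 = 1 - s\<^sup>2" by (simp add: s_def c_def cos_squared_eq)
  have pp: "pos_part (sol P) t = radius P t * x" "neg_part (sol P) t = radius P t * y"
    using radius_pos[of P t]
    by (auto simp: pos_part_def neg_part_def sol_def x_def y_def s_def max_def
        mult_le_0_iff zero_le_mult_iff)
  have "(flux P has_real_derivative radius P t * log_radius' P t * c
      - s * rhs P t (angle P t) * radius P t) (at t within {T1..T2})"
    unfolding flux_def s_def c_def
    by (rule derivative_eq_intros DERIV_radius DERIV_angle t refl)+ simp
  moreover have "log_radius' P t * c - s * rhs P t (angle P t) =
      q t * s - (fst P * m t * x - snd P * n t * y)"
  proof -
    have "log_radius' P t * c = (coeff_neg P t * y - coeff_pos P t * x) * c\<^sup>2"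
      by (simp add: log_radius'_def s_def c_def x_def y_def power2_eq_square)
    moreover have "s * rhs P t (angle P t) =
        s / p t + coeff_pos P t * (x * s\<^sup>2) + coeff_neg P t * (- y * s\<^sup>2)"
    proof -
      have cube: "x * (x * s) = x * s\<^sup>2" "y * (y * s) = - y * s\<^sup>2"
        by (auto simp: x_def y_def max_def power2_eq_square)
      have "s * rhs P t (angle P t) =
          s / p t + coeff_pos P t * (x * (x * s)) + coeff_neg P t * (y * (y * s))"
        by (simp add: rhs_def sin_pos_sq_def x_def y_def s_def power2_eq_square algebra_simps)
      then show ?thesis unfolding cube .
    qed
    ultimately have "log_radius' P t * c - s * rhs P t (angle P t) =
        coeff_neg P t * y - coeff_pos P t * x - s / p t"
      unfolding sc by (simp add: algebra_simps)
    also have "\<dots> = q t * s - (fst P * m t * x - snd P * n t * y)"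
      unfolding xy(3) by (simp add: coeff_neg_def coeff_pos_def algebra_simps diff_divide_distrib)
    finally show ?thesis .
  qed
  then have "radius P t * (log_radius' P t * c - s * rhs P t (angle P t)) =
      radius P t * (q t * s - (fst P * m t * x - snd P * n t * y))"
    by simp
  then have "radius P t * log_radius' P t * c - s * rhs P t (angle P t) * radius P t =
      radius P t * (q t * s - (fst P * m t * x - snd P * n t * y))"
    by (simp only: right_diff_distrib mult.assoc mult.commute mult.left_commute)
  moreover have "\<dots> = q t * sol P t - (fst P * m t * pos_part (sol P) t - snd P * n t * neg_part (sol P) t)"
    unfolding pp sol_def s_def[symmetric] by (simp add: algebra_simps)
  ultimately show ?thesis by simp
qed

lemma sol_T1: "sol P T1 = 0" and flux_T1: "flux P T1 = 1"
  by (simp_all add: sol_def flux_def radius_def angle_T1)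

lemma continuous_on_sol: "continuous_on {T1..T2} (sol P)"
  and continuous_on_flux: "continuous_on {T1..T2} (flux P)"
  by (rule DERIV_continuous_on[OF DERIV_sol] DERIV_continuous_on[OF DERIV_flux], assumption)+

text \<open>The problem is positively homogeneous, but not homogeneous: hence the sign condition on \<open>c\<close>.\<close>

lemma solves_scaled_sol:
  assumes "0 \<le> c"
  shows "solves P (\<lambda>t. c * sol P t) (\<lambda>t. c * flux P t)"
  unfolding solves_def
proof (intro conjI ballI)
  fix t assume t: "t \<in> {T1<..<T2}"
  have s: "(sol P has_real_derivative flux P t / p t) (at t)"
    using DERIV_sol[of t P] t by (simp add: at_within_Icc_at)
  have f: "(flux P has_real_derivative
    q t * sol P t - (fst P * m t * pos_part (sol P) t - snd P * n t * neg_part (sol P) t)) (at t)"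
    using DERIV_flux[of t P] t by (simp add: at_within_Icc_at)
  show "((\<lambda>t. c * sol P t) has_real_derivative c * flux P t / p t) (at t)"
    by (rule derivative_eq_intros s refl)+ simp
  have "pos_part (\<lambda>t. c * sol P t) t = c * pos_part (sol P) t"
    "neg_part (\<lambda>t. c * sol P t) t = c * neg_part (sol P) t"
    using assms by (auto simp: pos_part_def neg_part_def max_def mult_le_0_iff zero_le_mult_iff)
  then show "((\<lambda>t. c * flux P t) has_real_derivative q t * (c * sol P t) -
      (fst P * m t * pos_part (\<lambda>t. c * sol P t) t - snd P * n t * neg_part (\<lambda>t. c * sol P t) t)) (at t)"
    by (intro DERIV_cong[OF DERIV_cmult[OF f]]) (simp add: algebra_simps)
qed (auto intro!: continuous_intros continuous_on_sol continuous_on_flux simp: sol_T1)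

lemma solves_eq_sol:
  assumes "solves P u v" "0 \<le> v T1" "t \<in> {T1..T2}"
  shows "u t = v T1 * sol P t"
  using solves_unique[OF assms(1) solves_scaled_sol[OF assms(2)] _ assms(3)] by (simp add: flux_T1)

lemma sol_eq_0_iff: "sol P t = 0 \<longleftrightarrow> (\<exists>j::int. angle P t = of_int j * pi)"
  using radius_pos[of P t] by (auto simp: sol_def sin_zero_iff_int2)

lemma angle_inj_on_level:
  assumes "angle P s = of_int j * pi" "angle P t = of_int j * pi" "s \<in> {T1..T2}" "t \<in> {T1..T2}"
  shows "s = t"
proof (rule ccontr)
  assume "s \<noteq> t"
  then consider "s < t" | "t < s" by linarith
  then show False
    using angle_crosses_upwards[of s t j P] angle_crosses_upwards[of t s j P] assms by cases linarith+
qed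

text \<open>
  The angle climbs from \<open>0\<close> to \<open>N * pi\<close> and meets each of the \<open>N - 1\<close> multiples of \<open>pi\<close>
  strictly between exactly once.
\<close>

lemma sol_zeros:
  assumes "angle P T2 = real N * pi" "1 \<le> N"
  shows "exactly_zeros T1 T2 (N - 1) (sol P)"
proof -
  have "\<exists>z. T1 < z \<and> z < T2 \<and> angle P z = real j * pi" if j: "j \<in> {1..<N}" for j
  proof -
    have "real j * pi \<le> real N * pi" using j by (intro mult_right_mono) auto
    then obtain z where z: "T1 \<le> z" "z \<le> T2" "angle P z = real j * pi"
      using angle_attains[of T1 T2 P "real j * pi"] T assms(1) by (auto simp: angle_T1)
    have "z \<noteq> T1" using z(3) j by (auto simp: angle_T1)
    moreover have "z \<noteq> T2" using z(3) j assms(1) by auto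
    ultimately show ?thesis using z by (intro exI[of _ z]) simp
  qed
  then have "\<forall>j\<in>{1..<N}. \<exists>z. T1 < z \<and> z < T2 \<and> angle P z = real j * pi" by blast
  from bchoice[OF this] obtain z
    where z: "\<And>j. j \<in> {1..<N} \<Longrightarrow> T1 < z j \<and> z j < T2 \<and> angle P (z j) = real j * pi"
    by blast
  have "{t \<in> {T1<..<T2}. sol P t = 0} = z ` {1..<N}"
  proof safe
    fix t assume t: "t \<in> {T1<..<T2}" "sol P t = 0"
    then obtain j :: int where j: "angle P t = of_int j * pi" by (auto simp: sol_eq_0_iff)
    have "0 < of_int j * pi" using angle_pos[of t P] t j by simp
    then have "0 < j" by (simp add: zero_less_mult_iff)
    have "j < int N"
    proof (rule ccontr)
      assume "\<not> j < int N"
      then have "of_int (int N) \<le> (of_int j :: real)" by linarith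
      then have "of_int (int N) * pi \<le> angle P t" unfolding j by (intro mult_right_mono) auto
      then have "of_int (int N) * pi < angle P T2"
        using angle_crosses_upwards[of t T2 "int N" P] t(1) by simp
      then show False using assms by simp
    qed
    define i where "i = nat j"
    have i: "i \<in> {1..<N}" "j = int i" using \<open>0 < j\<close> \<open>j < int N\<close> by (auto simp: i_def)
    have zi: "T1 < z i" "z i < T2" "angle P (z i) = of_int j * pi"
      using z[OF i(1)] i(2) by auto
    have "t = z i"
      by (rule angle_inj_on_level[of P _ j]) (use zi t(1) j in simp_all)
    then show "t \<in> z ` {1..<N}" using i by auto
  next
    fix j assume "j \<in> {1..<N}"
    from z[OF this] have zj: "T1 < z j" "z j < T2" "angle P (z j) = of_int (int j) * pi" by auto
    from zj(1,2) show "z j \<in> {T1<..<T2}" by simp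
    show "sol P (z j) = 0" unfolding sol_eq_0_iff using zj(3) by blast
  qed
  moreover have "inj_on z {1..<N}"
  proof (rule inj_onI)
    fix i j assume ij: "i \<in> {1..<N}" "j \<in> {1..<N}" "z i = z j"
    have "real i * pi = real j * pi" using z[OF ij(1)] z[OF ij(2)] ij(3) by metis
    then show "i = j" by simp
  qed
  ultimately show ?thesis by (simp add: exactly_zeros_def card_image)
qed

lemma solves_angle_T2:
  assumes u: "solves P u v" "0 < v T1" "u T2 = 0" and k: "1 \<le> k"
    and z: "exactly_zeros T1 T2 (k - 1) u"
  shows "angle P T2 = real k * pi"
proof -
  have eq: "u t = v T1 * sol P t" if "t \<in> {T1..T2}" for t
    using solves_eq_sol[OF u(1) _ that] u(2) by simp
  have "sol P T2 = 0" using eq[of T2] u T by auto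
  then obtain j :: int where j: "angle P T2 = of_int j * pi" by (auto simp: sol_eq_0_iff)
  have "0 < of_int j * pi" using angle_pos[of T2 P] T j by simp
  then have "0 < j" by (simp add: zero_less_mult_iff)
  then obtain N where N: "j = int N" "1 \<le> N"
    using that[of "nat j"] by auto
  have "{t \<in> {T1<..<T2}. u t = 0} = {t \<in> {T1<..<T2}. sol P t = 0}"
    using eq u(2) by auto
  then have "N - 1 = k - 1"
    using z sol_zeros[of P N] N j by (simp add: exactly_zeros_def)
  then show ?thesis using N j k by simp
qed

lemma sol_is_fucik_solution:
  assumes "angle (a, b) T2 = real k * pi"
  shows "fucik_solution T1 T2 p q m n a b (sol (a, b))" "D T1 T2 (sol (a, b)) T1 > 0"
proof -
  have "continuous_on {T1..T2}
      (\<lambda>t. a * m t * pos_part (sol (a, b)) t - b * n t * neg_part (sol (a, b)) t)"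
    unfolding pos_part_def neg_part_def by (intro continuous_intros cont_m cont_n continuous_on_sol)
  moreover have "sol (a, b) T2 = 0" using assms by (auto simp: sol_eq_0_iff intro!: exI[of _ "int k"])
  ultimately show "fucik_solution T1 T2 p q m n a b (sol (a, b))" "D T1 T2 (sol (a, b)) T1 > 0"
    unfolding fucik_solution_def
    using dirichlet_solutionI[of T1 T2 p q
        "\<lambda>t. a * m t * pos_part (sol (a, b)) t - b * n t * neg_part (sol (a, b)) t"
        "sol (a, b)" "flux (a, b)"]
      DERIV_flux[where P = "(a, b)"] DERIV_sol[where P = "(a, b)"] T cont_p cont_q p_pos
    by (auto simp: flux_T1 sol_T1)
qed

lemma fucik_solution_solves:
  assumes "fucik_solution T1 T2 p q m n a b u"
  shows "solves (a, b) u (\<lambda>t. p t * D T1 T2 u t)" "u T2 = 0"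
  using dirichlet_solutionD[OF assms[unfolded fucik_solution_def] p_pos_ball] by (auto simp: solves_def)

lemma C_gt_iff_angle:
  assumes "1 \<le> k"
  shows "(a, b) \<in> C_gt T1 T2 p q m n k \<longleftrightarrow> angle (a, b) T2 = real k * pi"
proof
  assume "(a, b) \<in> C_gt T1 T2 p q m n k"
  then obtain u where u: "fucik_solution T1 T2 p q m n a b u" "exactly_zeros T1 T2 (k - 1) u"
    "D T1 T2 u T1 > 0"
    by (auto simp: C_gt_def)
  have "0 < p T1 * D T1 T2 u T1" using p_pos[of T1] T u(3) by simp
  then show "angle (a, b) T2 = real k * pi"
    using solves_angle_T2[OF fucik_solution_solves(1)[OF u(1)] _ fucik_solution_solves(2)[OF u(1)]]
      assms u(2) by auto
next
  assume "angle (a, b) T2 = real k * pi"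
  then show "(a, b) \<in> C_gt T1 T2 p q m n k"
    using sol_is_fucik_solution[of a b k] sol_zeros[of "(a, b)" k] assms by (auto simp: C_gt_def)
qed

end

section \<open>An energy identity\<close>

text \<open>
  Where \<open>u > 0\<close>, the derivative of \<open>u v\<close> is \<open>v\<^sup>2 / p + q u\<^sup>2 - w u\<^sup>2\<close>. So the function
  \<open>K t = \<integral> w (u\<^sup>+)\<^sup>2 + u\<^sup>+ v\<close>, integrated from \<open>T1\<close> to \<open>t\<close>, has a derivative \<open>\<ge> 0\<close> except at the finitely many
  zeros of \<open>u\<close>, where \<open>u\<^sup>+\<close> has kinks. At the ends the boundary term vanishes. The point \<open>r\<close> makes
  the increase strict.
\<close>

lemma energy_pos:
  assumes T: "T1 < T2" and cu: "continuous_on {T1..T2} u" and cv: "continuous_on {T1..T2} v"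
    and cw: "continuous_on {T1..T2} w"
    and p: "\<And>t. t \<in> {T1..T2} \<Longrightarrow> 0 < p t" and q: "\<And>t. t \<in> {T1..T2} \<Longrightarrow> 0 \<le> q t"
    and u: "\<And>t. t \<in> {T1<..<T2} \<Longrightarrow> (u has_real_derivative v t / p t) (at t)"
    and v: "\<And>t. t \<in> {T1<..<T2} \<Longrightarrow> 0 < u t \<Longrightarrow>
      (v has_real_derivative q t * u t - w t * u t) (at t)"
    and fin: "finite {t \<in> {T1<..<T2}. u t = 0}" and bc: "u T1 = 0" "u T2 = 0"
    and r: "r \<in> {T1<..<T2}" "0 < u r" "v r \<noteq> 0"
  shows "0 < integral {T1..T2} (\<lambda>t. w t * (max (u t) 0)\<^sup>2)"
proof -
  define F where "F t = w t * (max (u t) 0)\<^sup>2" for t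
  have cF: "continuous_on {T1..T2} F"
    unfolding F_def by (intro continuous_intros cw cu)
  define K where "K t = integral {T1..t} F + max (u t) 0 * v t" for t
  define k where "k t = (if 0 < u t then (v t)\<^sup>2 / p t + q t * (u t)\<^sup>2 else 0)" for t
  have cK: "continuous_on {T1..T2} K"
    unfolding K_def
    by (intro continuous_intros cu cv DERIV_continuous_on[OF integral_has_real_derivative[OF cF]])
  have dK: "(K has_real_derivative k t) (at t)" if t: "t \<in> {T1<..<T2}" "u t \<noteq> 0" for t
  proof -
    have dF: "((\<lambda>t. integral {T1..t} F) has_real_derivative F t) (at t)"
      using integral_has_real_derivative[OF cF, of t] t by (simp add: at_within_Icc_at)
    have "isCont u t" using DERIV_isCont u t by blast
    have "((\<lambda>t. max (u t) 0 * v t) has_real_derivative k t - F t) (at t)"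
    proof (cases "0 < u t")
      case True
      have "\<forall>\<^sub>F s in nhds t. 0 < u s"
        using \<open>isCont u t\<close> True by (simp add: isCont_def tendsto_at_iff_tendsto_nhds order_tendstoD(1))
      then have ev: "\<forall>\<^sub>F s in nhds t. max (u s) 0 * v s = u s * v s"
        by eventually_elim simp
      have "((\<lambda>t. u t * v t) has_real_derivative
          (v t / p t) * v t + (q t * u t - w t * u t) * u t) (at t)"
        by (rule DERIV_mult[OF u[OF t(1)] v[OF t(1) True]])
      moreover have "(v t / p t) * v t + (q t * u t - w t * u t) * u t = k t - F t"
        using True by (simp add: k_def F_def power2_eq_square algebra_simps)
      ultimately show ?thesis using DERIV_cong_ev[OF refl ev refl] by simp
    next
      case False
      with t have "u t < 0" by simp
      then have "\<forall>\<^sub>F s in nhds t. u s < 0"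
        using \<open>isCont u t\<close> by (simp add: isCont_def tendsto_at_iff_tendsto_nhds order_tendstoD(2))
      then have ev: "\<forall>\<^sub>F s in nhds t. max (u s) 0 * v s = 0"
        by eventually_elim simp
      show ?thesis using DERIV_cong_ev[OF refl ev refl] False \<open>u t < 0\<close> by (simp add: k_def F_def)
    qed
    from DERIV_add[OF dF this] show ?thesis unfolding K_def by simp
  qed
  have k_nonneg: "0 \<le> k t" if "t \<in> {T1..T2}" for t
    using p[OF that] q[OF that] by (simp add: k_def)
  have mono: "K s \<le> K t" if st: "T1 \<le> s" "s \<le> t" "t \<le> T2" for s t
  proof -
    have "(k has_integral (K t - K s)) {s..t}"
    proof (rule fundamental_theorem_of_calculus_interior_strong[OF fin st(2)])
      fix x assume "x \<in> {s<..<t} - {t \<in> {T1<..<T2}. u t = 0}"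
      then show "(K has_vector_derivative k x) (at x)"
        using dK[of x] st by (auto simp: has_real_derivative_iff_has_vector_derivative)
    qed (use st in \<open>auto intro: continuous_on_subset[OF cK]\<close>)
    then have "0 \<le> K t - K s"
      using has_integral_nonneg k_nonneg st by (metis atLeastAtMost_iff order_trans)
    then show ?thesis by simp
  qed
  have "K T1 = 0" "K T2 = integral {T1..T2} F" using bc by (simp_all add: K_def)
  moreover have "K T1 < K T2"
  proof (rule ccontr)
    assume "\<not> K T1 < K T2"
    then have const: "K t = K T1" if "t \<in> {T1<..<T2}" for t
      using mono[of T1 t] mono[of t T2] that by auto
    have "0 < k r" using r p[of r] q[of r] by (simp add: k_def add_pos_nonneg)
    moreover have "(K has_real_derivative k r) (at r)" using dK r by simp
    ultimately obtain e where e: "0 < e" "\<And>h. 0 < h \<Longrightarrow> h < e \<Longrightarrow> K r < K (r + h)"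
      using DERIV_pos_inc_right by blast
    define h where "h = min (e / 2) ((T2 - r) / 2)"
    have h: "0 < h" "h < e" "r + h \<in> {T1<..<T2}"
      using e r by (auto simp: h_def min_def field_simps)
    show False using e(2)[OF h(1,2)] const[OF h(3)] const[OF r(1)] by simp
  qed
  ultimately show ?thesis by (simp add: F_def[abs_def])
qed

context fucik_problem
begin

lemma exp_gap_exponent_diag:
  assumes "t \<in> {T1..T2}"
  shows "exp (- gap_exponent (P, P) t) = (radius P t)\<^sup>2"
proof -
  have "gap_slope (P, P) = (\<lambda>t. - 2 * log_radius' P t)"
    by (rule ext) (simp add: gap_slope_def rhs_slope_def slope_def sin_pos_sq'_def log_radius'_def algebra_simps)
  then have "gap_exponent (P, P) t = - 2 * integral {T1..t} (log_radius' P)"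
    unfolding gap_exponent_def by (simp only: integral_mult_right)
  then show ?thesis
    by (simp add: radius_def power2_eq_square exp_add[symmetric])
qed

text \<open>
  On the diagonal the exponential weights become \<open>(radius P t)\<^sup>2 / (radius P T2)\<^sup>2\<close>, and the factor
  \<open>(radius P t)\<^sup>2\<close> turns the squared sine into the square of the solution.
\<close>

lemma sens_diag:
  "sens_a (P, P) = integral {T1..T2} (\<lambda>t. m t * (max (sol P t) 0)\<^sup>2) / (radius P T2)\<^sup>2"
  "sens_b (P, P) = integral {T1..T2} (\<lambda>t. n t * (max (- sol P t) 0)\<^sup>2) / (radius P T2)\<^sup>2"
proof -
  have E: "exp (gap_exponent (P, P) T2) = 1 / (radius P T2)\<^sup>2"
    using exp_gap_exponent_diag[of T2 P] T radius_pos[of P T2] by (simp add: exp_minus field_simps)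
  have scale: "(radius P t)\<^sup>2 * (max x 0)\<^sup>2 = (max (radius P t * x) 0)\<^sup>2" for t x
    using radius_pos[of P t] by (simp add: max_def power_mult_distrib mult_le_0_iff zero_le_mult_iff)
  have "integral {T1..T2} (\<lambda>s. exp (- gap_exponent (P, P) s) * (m s * sin_pos_sq (angle P s)))
      = integral {T1..T2} (\<lambda>t. m t * (max (sol P t) 0)\<^sup>2)"
    by (rule integral_cong)
      (simp add: exp_gap_exponent_diag sin_pos_sq_def sol_def scale[symmetric])
  then show "sens_a (P, P) = integral {T1..T2} (\<lambda>t. m t * (max (sol P t) 0)\<^sup>2) / (radius P T2)\<^sup>2"
    by (simp add: sens_a_def E)
  have "integral {T1..T2} (\<lambda>s. exp (- gap_exponent (P, P) s) * (n s * sin_pos_sq (- angle P s)))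
      = integral {T1..T2} (\<lambda>t. n t * (max (- sol P t) 0)\<^sup>2)"
  proof (rule integral_cong)
    fix t assume "t \<in> {T1..T2}"
    moreover have "(max (- sol P t) 0)\<^sup>2 = (radius P t)\<^sup>2 * (max (- sin (angle P t)) 0)\<^sup>2"
      using scale[of t "- sin (angle P t)"] by (simp add: sol_def)
    ultimately show "exp (- gap_exponent (P, P) t) * (n t * sin_pos_sq (- angle P t))
        = n t * (max (- sol P t) 0)\<^sup>2"
      by (simp add: exp_gap_exponent_diag sin_pos_sq_def)
  qed
  then show "sens_b (P, P) = integral {T1..T2} (\<lambda>t. n t * (max (- sol P t) 0)\<^sup>2) / (radius P T2)\<^sup>2"
    by (simp add: sens_b_def E)
qed

text \<open>
  With \<open>k \<ge> 2\<close> the angle passes through \<open>\<pi> / 4\<close> and \<open>5 \<pi> / 4\<close>; at these times \<open>sol\<close> and \<open>- sol\<close>,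
  respectively, are positive with nonzero flux, as \<open>energy_pos\<close> demands.
\<close>

lemma sens_diag_pos:
  assumes "0 < a" "0 < b" and k: "2 \<le> k" "angle (a, b) T2 = real k * pi"
  shows "0 < sens_a ((a, b), (a, b))" "0 < sens_b ((a, b), (a, b))"
proof -
  let ?P = "(a, b)"
  have "sol ?P T2 = 0" using k by (auto simp: sol_eq_0_iff intro!: exI[of _ "int k"])
  have fin: "finite {t \<in> {T1<..<T2}. sol ?P t = 0}"
    using sol_zeros[OF k(2)] k(1) by (simp add: exactly_zeros_def)
  have d: "(sol ?P has_real_derivative flux ?P t / p t) (at t)"
    "(flux ?P has_real_derivative
      q t * sol ?P t - (a * m t * pos_part (sol ?P) t - b * n t * neg_part (sol ?P) t)) (at t)"
    if "t \<in> {T1<..<T2}" for t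
    using DERIV_sol[of t ?P] DERIV_flux[of t ?P] that by (simp_all add: at_within_Icc_at)
  have pt: "\<exists>t\<in>{T1<..<T2}. angle ?P t = c" if "0 < c" "c < 2 * pi" for c
  proof -
    have "2 * pi \<le> real k * pi" using k(1) by (intro mult_right_mono) auto
    with that have "0 \<le> c" "c < angle ?P T2" unfolding k(2) by linarith+
    then obtain t where t: "T1 \<le> t" "t \<le> T2" "angle ?P t = c"
      using angle_attains[of T1 T2 ?P c] T by (auto simp: angle_T1)
    have "t \<noteq> T1" using t(3) that by (auto simp: angle_T1)
    moreover have "t \<noteq> T2" using t(3) \<open>c < angle ?P T2\<close> by auto
    ultimately show ?thesis using t by (intro bexI[of _ t]) auto
  qed
  have "pi / 4 < 2 * pi" "5 * pi / 4 < 2 * pi" "0 < pi / 4" "0 < 5 * pi / 4"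
    using pi_gt_zero by linarith+
  then obtain r r' where r: "r \<in> {T1<..<T2}" "angle ?P r = pi / 4"
    and r': "r' \<in> {T1<..<T2}" "angle ?P r' = 5 * pi / 4"
    using pt[of "pi / 4"] pt[of "5 * pi / 4"] by auto
  have trig: "sin (5 * pi / 4) < 0" "cos (5 * pi / 4) \<noteq> 0"
  proof -
    have "5 * pi / 4 = pi / 4 + pi" by simp
    then show "sin (5 * pi / 4) < 0" "cos (5 * pi / 4) \<noteq> 0"
      by (simp_all only: sin_periodic_pi cos_periodic_pi) (simp_all add: sin_45 cos_45)
  qed
  have "0 < integral {T1..T2} (\<lambda>t. (a * m t) * (max (sol ?P t) 0)\<^sup>2)"
  proof (rule energy_pos[OF T continuous_on_sol continuous_on_flux _ p_pos q_nonneg])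
    show "(flux ?P has_real_derivative q t * sol ?P t - a * m t * sol ?P t) (at t)"
      if "t \<in> {T1<..<T2}" "0 < sol ?P t" for t
      using d(2)[OF that(1)] that(2) by (simp add: pos_part_def neg_part_def)
    show "r \<in> {T1<..<T2}" by fact
    show "0 < sol ?P r" "flux ?P r \<noteq> 0"
      using radius_pos[of ?P r] unfolding sol_def flux_def r(2) by (simp_all add: sin_45 cos_45)
  qed (use d fin \<open>sol ?P T2 = 0\<close> in \<open>auto intro!: continuous_intros cont_m simp: sol_T1\<close>)
  also have "\<dots> = a * integral {T1..T2} (\<lambda>t. m t * (max (sol ?P t) 0)\<^sup>2)"
    by (simp only: mult.assoc integral_mult_right)
  finally have "0 < integral {T1..T2} (\<lambda>t. m t * (max (sol ?P t) 0)\<^sup>2)"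
    using assms(1) by (simp add: zero_less_mult_iff)
  then show "0 < sens_a (?P, ?P)"
    using radius_pos[of ?P T2] by (simp add: sens_diag)
  have "0 < integral {T1..T2} (\<lambda>t. (b * n t) * (max (- sol ?P t) 0)\<^sup>2)"
  proof (rule energy_pos[OF T _ _ _ p_pos q_nonneg, where v = "\<lambda>t. - flux ?P t"])
    show "((\<lambda>t. - flux ?P t) has_real_derivative q t * - sol ?P t - b * n t * - sol ?P t) (at t)"
      if "t \<in> {T1<..<T2}" "0 < - sol ?P t" for t
      using DERIV_minus[OF d(2)[OF that(1)]] that(2) by (simp add: pos_part_def neg_part_def)
    show "((\<lambda>t. - sol ?P t) has_real_derivative - flux ?P t / p t) (at t)"
      if "t \<in> {T1<..<T2}" for t
      using DERIV_minus[OF d(1)[OF that]] by simp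
    show "r' \<in> {T1<..<T2}" by fact
    show "0 < - sol ?P r'" "- flux ?P r' \<noteq> 0"
      using radius_pos[of ?P r'] trig unfolding sol_def flux_def r'(2)
      by (simp_all add: mult_less_0_iff)
  qed (use fin \<open>sol ?P T2 = 0\<close> in
      \<open>auto intro!: continuous_intros cont_n continuous_on_sol continuous_on_flux simp: sol_T1\<close>)
  also have "\<dots> = b * integral {T1..T2} (\<lambda>t. n t * (max (- sol ?P t) 0)\<^sup>2)"
    by (simp only: mult.assoc integral_mult_right)
  finally have "0 < integral {T1..T2} (\<lambda>t. n t * (max (- sol ?P t) 0)\<^sup>2)"
    using assms(2) by (simp add: zero_less_mult_iff)
  then show "0 < sens_b (?P, ?P)"
    using radius_pos[of ?P T2] by (simp add: sens_diag)
qed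

end

section \<open>The first eigenvalue\<close>

locale eigenvalue_problem = fucik_problem T1 T2 p q m m for T1 T2 p q m
begin

lemma dirichlet_solution_solves:
  assumes "dirichlet_solution T1 T2 p q (\<lambda>t. l * m t * u t) u" "s = 1 \<or> s = - 1"
  shows "solves (l, l) (\<lambda>t. s * u t) (\<lambda>t. s * (p t * D T1 T2 u t))"
proof -
  note u = dirichlet_solutionD[OF assms(1) p_pos_ball]
  have "l * m t * pos_part w t - l * m t * neg_part w t = l * m t * w t" for w t
    by (simp add: pos_part_def neg_part_def max_def)
  moreover have "((\<lambda>t. s * u t) has_real_derivative s * (p t * D T1 T2 u t) / p t) (at t)"
    "((\<lambda>t. s * (p t * D T1 T2 u t)) has_real_derivative q t * (s * u t) - l * m t * (s * u t)) (at t)"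
    if "t \<in> {T1<..<T2}" for t
  proof -
    show "((\<lambda>t. s * u t) has_real_derivative s * (p t * D T1 T2 u t) / p t) (at t)"
      by (rule DERIV_cong[OF DERIV_cmult[OF u(3)[OF that], of s]]) simp
    show "((\<lambda>t. s * (p t * D T1 T2 u t)) has_real_derivative
        q t * (s * u t) - l * m t * (s * u t)) (at t)"
      by (rule DERIV_cong[OF DERIV_cmult[OF u(4)[OF that], of s]]) (simp add: algebra_simps)
  qed
  ultimately show ?thesis
    using u by (auto simp: solves_def intro!: continuous_intros)
qed

text \<open>
  Every eigenfunction is a multiple of \<open>sol (l, l)\<close>; a negative factor is admissible here because the equation
  is linear when both weights and both parameters agree.
\<close>

lemma eigenvalue_iff: "eigenvalue T1 T2 p q m l \<longleftrightarrow> sin (angle (l, l) T2) = 0"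
proof
  assume "eigenvalue T1 T2 p q m l"
  then obtain u t where u: "dirichlet_solution T1 T2 p q (\<lambda>t. l * m t * u t) u"
    and t: "t \<in> {T1..T2}" "u t \<noteq> 0"
    by (auto simp: eigenvalue_def)
  define s :: real where "s = (if 0 \<le> p T1 * D T1 T2 u T1 then 1 else - 1)"
  define c where "c = s * (p T1 * D T1 T2 u T1)"
  have "0 \<le> c" "s = 1 \<or> s = - 1" by (auto simp: c_def s_def)
  then have eq: "s * u t = c * sol (l, l) t" if "t \<in> {T1..T2}" for t
    using solves_eq_sol[OF dirichlet_solution_solves[OF u, of s] _ that] by (simp add: c_def)
  have "c \<noteq> 0" using eq[OF t(1)] t(2) \<open>s = 1 \<or> s = - 1\<close> by auto
  moreover have "u T2 = 0" using u by (simp add: dirichlet_solution_def)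
  ultimately have "sol (l, l) T2 = 0" using eq[of T2] T by simp
  then show "sin (angle (l, l) T2) = 0" using radius_pos[of "(l, l)" T2] by (simp add: sol_def)
next
  assume "sin (angle (l, l) T2) = 0"
  then have "sol (l, l) T2 = 0" by (simp add: sol_def)
  have lin: "l * m t * pos_part w t - l * m t * neg_part w t = l * m t * w t" for w t
    by (simp add: pos_part_def neg_part_def max_def)
  have "dirichlet_solution T1 T2 p q (\<lambda>t. l * m t * sol (l, l) t) (sol (l, l))"
  proof (rule dirichlet_solutionI(1)[OF T cont_p p_pos cont_q])
    show "(flux (l, l) has_real_derivative q t * sol (l, l) t - l * m t * sol (l, l) t)
        (at t within {T1..T2})" if "t \<in> {T1..T2}" for t
      using DERIV_flux[OF that, of "(l, l)"] by (simp add: lin)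
  qed (use \<open>sol (l, l) T2 = 0\<close> in
      \<open>auto intro!: continuous_intros cont_m continuous_on_sol DERIV_sol simp: sol_T1\<close>)
  moreover obtain t where t: "t \<in> {T1<..<T2}" "sol (l, l) t \<noteq> 0"
  proof -
    have "angle (l, l) T1 < pi" by (simp add: angle_T1)
    moreover have "continuous_on {T1..T2} (angle (l, l))" by (rule continuous_on_angle)
    ultimately obtain e where e: "0 < e"
      "\<And>t. t \<in> {T1..T2} \<Longrightarrow> dist t T1 < e \<Longrightarrow> dist (angle (l, l) t) (angle (l, l) T1) < pi"
      unfolding continuous_on_iff using T by (metis atLeastAtMost_iff less_imp_le order_refl pi_gt_zero)
    define t where "t = T1 + min (e / 2) ((T2 - T1) / 2)"
    have t: "T1 < t" "t < T2" "dist t T1 < e"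
      using e T by (auto simp: t_def dist_real_def min_def field_simps)
    then have "angle (l, l) t < pi" "0 < angle (l, l) t"
      using e(2)[of t] angle_pos[of t "(l, l)"] by (auto simp: angle_T1 dist_real_def)
    then have "0 < sol (l, l) t" using radius_pos[of "(l, l)" t] sin_gt_zero by (simp add: sol_def)
    then show ?thesis using t by (intro that[of t]) auto
  qed
  ultimately show "eigenvalue T1 T2 p q m l"
    unfolding eigenvalue_def by (intro exI[of _ "sol (l, l)"] conjI bexI[of _ t]) auto
qed

text \<open>Since \<open>q \<ge> 0\<close>, the constant \<open>pi / 2\<close> is a supersolution of the angle equation with parameter \<open>0\<close>.\<close>

lemma angle_at_zero: "angle (0, 0) T2 < pi / 2"
proof -
  have rhs_half: "rhs (0, 0) t (pi / 2) = - q t" for t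
    by (simp add: rhs_def sin_pos_sq_def coeff_pos_def)
  have "0 < pi / 2 - angle (0, 0) T2"
  proof (rule linear_ode_nonneg(2)[where w = "\<lambda>t. pi / 2 - angle (0, 0) t" and h = q
      and G = "\<lambda>t. rhs_slope (0, 0) t (pi / 2) (angle (0, 0) t)" and a = T1 and b = T2])
    show "((\<lambda>t. pi / 2 - angle (0, 0) t) has_real_derivative
        rhs_slope (0, 0) t (pi / 2) (angle (0, 0) t) * (pi / 2 - angle (0, 0) t) + q t)
        (at t within {T1..T2})" if "t \<in> {T1..T2}" for t
      unfolding rhs_slope[symmetric] rhs_half
      by (rule derivative_eq_intros DERIV_angle that refl)+ simp
  qed (use T in \<open>auto intro!: cont_q q_nonneg continuous_on_rhs_slope continuous_intros
        continuous_on_angle simp: angle_T1\<close>)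
  then show ?thesis by simp
qed

lemma continuous_on_angle_T2: "continuous_on S (\<lambda>l. angle (l, l) T2)"
  using T by (intro continuous_on_angle_compose continuous_intros) auto

text \<open>
  Between \<open>0\<close> and \<open>l\<close> the final angle takes the value \<open>pi\<close>, at a positive eigenvalue. The nonnegative
  parameters whose final angle is a multiple of \<open>pi\<close> form a closed set without \<open>0\<close>, so a smallest positive
  eigenvalue exists.
\<close>

lemma lambda1_bounds:
  assumes "0 < l" "pi \<le> angle (l, l) T2"
  shows "0 < lambda1 T1 T2 p q m \<and> lambda1 T1 T2 p q m \<le> l"
proof -
  have "angle (0, 0) T2 \<le> pi" using angle_at_zero pi_gt_zero by linarith
  have "\<exists>s\<ge>0. s \<le> l \<and> angle (s, s) T2 = pi"
    using assms \<open>angle (0, 0) T2 \<le> pi\<close>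
    by (intro IVT'[where f = "\<lambda>s. angle (s, s) T2"] continuous_on_angle_T2) auto
  then obtain s where s: "0 \<le> s" "s \<le> l" "angle (s, s) T2 = pi" by blast
  define X where "X = {l. 0 \<le> l \<and> sin (angle (l, l) T2) = 0}"
  have "closed X"
    unfolding X_def
    by (intro closed_Collect_conj closed_Collect_le closed_Collect_eq continuous_intros
        continuous_on_angle_T2)
  have "s \<in> X" using s by (simp add: X_def)
  have bdd: "bdd_below X" by (rule bdd_belowI[of _ 0]) (simp add: X_def)
  have inf: "Inf X \<in> X"
    using closed_contains_Inf[OF _ bdd \<open>closed X\<close>] \<open>s \<in> X\<close> by blast
  have "0 < angle (0, 0) T2" using angle_pos[of T2] T by simp
  then have "sin (angle (0, 0) T2) \<noteq> 0"
    using angle_at_zero sin_gt_zero[of "angle (0, 0) T2"] by simp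
  then have "0 \<notin> X" by (simp add: X_def)
  have X: "0 < l \<and> eigenvalue T1 T2 p q m l \<longleftrightarrow> l \<in> X" for l
    using \<open>0 \<notin> X\<close> by (cases "l = 0") (auto simp: eigenvalue_iff X_def)
  have "lambda1 T1 T2 p q m = Inf X"
    unfolding lambda1_def X using inf cInf_lower[OF _ bdd] by (intro Least_equality)
  moreover have "Inf X \<le> s" by (rule cInf_lower[OF \<open>s \<in> X\<close> bdd])
  moreover have "0 < Inf X" using inf X by blast
  ultimately show ?thesis using s by simp
qed

text \<open>
  Sturm comparison: an arc \<open>\<psi>\<close> of the same equation that starts at \<open>0\<close> cannot overtake the angle, which
  is nonnegative when the arc starts.
\<close>

lemma angle_ge_pi_of_arc:
  assumes x: "T1 \<le> x" "x < z" "z \<le> T2"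
    and \<psi>: "\<And>t. t \<in> {x..z} \<Longrightarrow> (\<psi> has_real_derivative rhs (l, l) t (\<psi> t)) (at t within {x..z})"
    and ends: "\<psi> x = 0" "\<psi> z = pi"
  shows "pi \<le> angle (l, l) T2"
proof -
  have sub: "{x..z} \<subseteq> {T1..T2}" using x by auto
  have "0 \<le> angle (l, l) z - \<psi> z"
  proof (rule linear_ode_nonneg(1)[where w = "\<lambda>t. angle (l, l) t - \<psi> t" and h = "\<lambda>_. 0"
      and G = "\<lambda>t. rhs_slope (l, l) t (angle (l, l) t) (\<psi> t)" and a = x and b = z])
    show "((\<lambda>t. angle (l, l) t - \<psi> t) has_real_derivative
        rhs_slope (l, l) t (angle (l, l) t) (\<psi> t) * (angle (l, l) t - \<psi> t) + 0)
        (at t within {x..z})" if t: "t \<in> {x..z}" for t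
      unfolding rhs_slope[symmetric]
      using DERIV_diff[OF has_field_derivative_subset[OF DERIV_angle sub] \<psi>[OF t]] t sub by auto
    show "continuous_on {x..z} (\<lambda>t. rhs_slope (l, l) t (angle (l, l) t) (\<psi> t))"
      using sub by (intro continuous_on_rhs_slope continuous_intros DERIV_continuous_on[OF \<psi>]
          continuous_on_subset[OF continuous_on_angle]) auto
    have "0 \<le> angle (l, l) x"
      using angle_pos[of x "(l, l)"] x by (cases "x = T1") (auto simp: angle_T1)
    then show "0 \<le> angle (l, l) x - \<psi> x" by (simp add: ends)
  qed (use x in auto)
  then have "pi \<le> angle (l, l) z" by (simp add: ends)
  then show ?thesis
    using angle_crosses_upwards[of z T2 1 "(l, l)"] x by (cases "z = T2") auto
qed

end

context fucik_problem
begin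

text \<open>
  While the angle runs from \<open>0\<close> to \<open>\<pi>\<close> the solution is positive and only \<open>(a, m)\<close> enters; from \<open>\<pi>\<close> to
  \<open>2 \<pi>\<close> only \<open>(b, n)\<close> does. Each piece, the second one shifted by \<open>\<pi>\<close>, is an arc of a linear problem.
\<close>

lemma lambda1_thresholds:
  assumes ab: "0 < a" "0 < b" and ge: "2 * pi \<le> angle (a, b) T2"
  shows "0 < lambda1 T1 T2 p q m \<and> lambda1 T1 T2 p q m \<le> a"
    and "0 < lambda1 T1 T2 p q n \<and> lambda1 T1 T2 p q n \<le> b"
proof -
  interpret M: eigenvalue_problem T1 T2 p q m
    by unfold_locales (use T cont_p cont_q cont_m p_pos q_nonneg in auto)
  interpret N: eigenvalue_problem T1 T2 p q n
    by unfold_locales (use T cont_p cont_q cont_n p_pos q_nonneg in auto)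
  let ?\<theta> = "angle (a, b)"
  obtain z1 where z1: "T1 \<le> z1" "z1 \<le> T2" "?\<theta> z1 = pi"
    using angle_attains[of T1 T2 "(a, b)" pi] T ge pi_gt_zero by (auto simp: angle_T1)
  obtain z2 where z2: "z1 \<le> z2" "z2 \<le> T2" "?\<theta> z2 = 2 * pi"
    using angle_attains[of z1 T2 "(a, b)" "2 * pi"] z1 ge pi_gt_zero by auto
  have "T1 \<noteq> z1" using z1(3) angle_T1[of "(a, b)"] pi_neq_zero by metis
  with z1 have "T1 < z1" by simp
  have "z1 < z2" using z1 z2 pi_gt_zero by (cases "z1 = z2") auto
  have pos_arc: "0 \<le> sin (?\<theta> t)" if t: "t \<in> {T1..z1}" for t
  proof -
    have "0 \<le> ?\<theta> t" using angle_pos[of t "(a, b)"] t z1 by (cases "t = T1") (auto simp: angle_T1)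
    moreover have "?\<theta> t \<le> pi"
      using angle_crosses_upwards[of t z1 1 "(a, b)"] t z1 by (cases "t = z1") force+
    ultimately show ?thesis by (rule sin_ge_zero)
  qed
  have neg_arc: "sin (?\<theta> t) \<le> 0" if t: "t \<in> {z1..z2}" for t
  proof -
    have "pi \<le> ?\<theta> t"
      using angle_crosses_upwards[of z1 t 1 "(a, b)"] t z1 z2 by (cases "t = z1") auto
    moreover have "?\<theta> t \<le> 2 * pi"
      using angle_crosses_upwards[of t z2 2 "(a, b)"] t z1 z2 by (cases "t = z2") force+
    ultimately have "0 \<le> sin (?\<theta> t - pi)" by (intro sin_ge_zero) auto
    then show ?thesis by simp
  qed
  have "pi \<le> M.angle (a, a) T2"
  proof (rule M.angle_ge_pi_of_arc[of T1 z1 ?\<theta>])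
    fix t assume t: "t \<in> {T1..z1}"
    then have "sin_pos_sq (- ?\<theta> t) = 0" using pos_arc by (simp add: sin_pos_sq_def)
    then have "M.rhs (a, a) t (?\<theta> t) = rhs (a, b) t (?\<theta> t)"
      by (simp add: M.rhs_def rhs_def M.coeff_pos_def coeff_pos_def)
    then show "(?\<theta> has_real_derivative M.rhs (a, a) t (?\<theta> t)) (at t within {T1..z1})"
      using has_field_derivative_subset[OF DERIV_angle[of t "(a, b)"], of "{T1..z1}"] t z1 by auto
  qed (use \<open>T1 < z1\<close> z1 in \<open>auto simp: angle_T1\<close>)
  then show "0 < lambda1 T1 T2 p q m \<and> lambda1 T1 T2 p q m \<le> a"
    using M.lambda1_bounds ab by simp
  have "pi \<le> N.angle (b, b) T2"
  proof (rule N.angle_ge_pi_of_arc[of z1 z2 "\<lambda>t. ?\<theta> t - pi"])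
    fix t assume t: "t \<in> {z1..z2}"
    have "sin_pos_sq (?\<theta> t) = 0" "sin_pos_sq (- (?\<theta> t - pi)) = 0"
      "sin_pos_sq (?\<theta> t - pi) = sin_pos_sq (- ?\<theta> t)"
      using neg_arc[OF t] sin_minus[of "?\<theta> t - pi"] by (auto simp: sin_pos_sq_def)
    then have "N.rhs (b, b) t (?\<theta> t - pi) = rhs (a, b) t (?\<theta> t)"
      by (simp add: N.rhs_def rhs_def N.coeff_pos_def coeff_neg_def)
    moreover have "((\<lambda>t. ?\<theta> t - pi) has_real_derivative rhs (a, b) t (?\<theta> t)) (at t within {z1..z2})"
      using has_field_derivative_subset[OF DERIV_angle[of t "(a, b)"], of "{z1..z2}"] t z1 z2
      by (auto intro!: derivative_eq_intros)
    ultimately show "((\<lambda>t. ?\<theta> t - pi) has_real_derivative N.rhs (b, b) t (?\<theta> t - pi))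
        (at t within {z1..z2})"
      by simp
  qed (use \<open>z1 < z2\<close> z1 z2 in auto)
  then show "0 < lambda1 T1 T2 p q n \<and> lambda1 T1 T2 p q n \<le> b"
    using N.lambda1_bounds ab by simp
qed

section \<open>The Fucik curves\<close>

text \<open>
  The negative of a solution for weights \<open>n\<close>, \<open>m\<close> and parameters \<open>b\<close>, \<open>a\<close> is one for weights \<open>m\<close>, \<open>n\<close> and
  parameters \<open>a\<close>, \<open>b\<close>.
\<close>

lemma C_lt_iff_angle:
  assumes "1 \<le> k"
  shows "(b, a) \<in> C_lt T1 T2 p q n m k \<longleftrightarrow> angle (a, b) T2 = real k * pi"
proof
  assume "(b, a) \<in> C_lt T1 T2 p q n m k"
  then obtain u where u: "fucik_solution T1 T2 p q n m b a u" "exactly_zeros T1 T2 (k - 1) u"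
    "D T1 T2 u T1 < 0"
    by (auto simp: C_lt_def)
  define v where "v t = p t * D T1 T2 u t" for t
  note uv = dirichlet_solutionD[OF u(1)[unfolded fucik_solution_def] p_pos_ball, folded v_def]
  have "solves (a, b) (\<lambda>t. - u t) (\<lambda>t. - v t)"
    unfolding solves_def
  proof (intro conjI ballI)
    fix t assume t: "t \<in> {T1<..<T2}"
    show "((\<lambda>t. - u t) has_real_derivative - v t / p t) (at t)"
      using DERIV_minus[OF uv(3)[OF t]] by simp
    have "pos_part (\<lambda>t. - u t) t = neg_part u t" "neg_part (\<lambda>t. - u t) t = pos_part u t"
      by (simp_all add: pos_part_def neg_part_def)
    then show "((\<lambda>t. - v t) has_real_derivative q t * - u t - (fst (a, b) * m t * pos_part (\<lambda>t. - u t) t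
        - snd (a, b) * n t * neg_part (\<lambda>t. - u t) t)) (at t)"
      by (intro DERIV_cong[OF DERIV_minus[OF uv(4)[OF t]]]) simp
  qed (use uv in \<open>auto intro!: continuous_intros\<close>)
  moreover have "0 < - v T1" using u(3) p_pos[of T1] T by (simp add: v_def mult_pos_neg)
  moreover have "exactly_zeros T1 T2 (k - 1) (\<lambda>t. - u t)" using u(2) by (simp add: exactly_zeros_def)
  ultimately show "angle (a, b) T2 = real k * pi"
    using solves_angle_T2[of "(a, b)" "\<lambda>t. - u t" "\<lambda>t. - v t" k] uv(6) assms by simp
next
  assume k: "angle (a, b) T2 = real k * pi"
  let ?P = "(a, b)"
  have "sol ?P T2 = 0" using k by (auto simp: sol_eq_0_iff intro!: exI[of _ "int k"])
  let ?g = "\<lambda>t. b * n t * pos_part (\<lambda>t. - sol ?P t) t - a * m t * neg_part (\<lambda>t. - sol ?P t) t"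
  have swap: "pos_part (\<lambda>t. - sol ?P t) t = neg_part (sol ?P) t"
    "neg_part (\<lambda>t. - sol ?P t) t = pos_part (sol ?P) t" for t
    by (simp_all add: pos_part_def neg_part_def)
  have cg: "continuous_on {T1..T2} ?g"
    unfolding pos_part_def neg_part_def by (intro continuous_intros cont_m cont_n continuous_on_sol)
  have u: "((\<lambda>t. - sol ?P t) has_real_derivative - flux ?P t / p t) (at t within {T1..T2})"
    if "t \<in> {T1..T2}" for t
    using DERIV_minus[OF DERIV_sol[OF that, of ?P]] by simp
  have v: "((\<lambda>t. - flux ?P t) has_real_derivative q t * - sol ?P t - ?g t) (at t within {T1..T2})"
    if "t \<in> {T1..T2}" for t
    unfolding swap by (rule DERIV_cong[OF DERIV_minus[OF DERIV_flux[OF that, of ?P]]]) simp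
  have "fucik_solution T1 T2 p q n m b a (\<lambda>t. - sol ?P t)"
    unfolding fucik_solution_def
    by (rule dirichlet_solutionI(1)[OF T cont_p p_pos cont_q cg u v])
      (use \<open>sol ?P T2 = 0\<close> in \<open>auto simp: sol_T1\<close>)
  moreover have "D T1 T2 (\<lambda>t. - sol ?P t) T1 = - flux ?P T1 / p T1"
    by (rule dirichlet_solutionI(2)[OF T cont_p p_pos cont_q cg u v])
      (use \<open>sol ?P T2 = 0\<close> in \<open>auto simp: sol_T1\<close>)
  then have "D T1 T2 (\<lambda>t. - sol ?P t) T1 < 0" using p_pos[of T1] T by (simp add: flux_T1)
  moreover have "exactly_zeros T1 T2 (k - 1) (\<lambda>t. - sol ?P t)"
    using sol_zeros[OF k] assms by (simp add: exactly_zeros_def)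
  ultimately show "(b, a) \<in> C_lt T1 T2 p q n m k" by (auto simp: C_lt_def)
qed

end

theorem theorem3p4:
  fixes T1 T2 :: real and p q m n :: "real \<Rightarrow> real" and k :: nat
  assumes "T1 < T2"
    and "continuous_on {T1..T2} p" and "continuous_on {T1..T2} q"
    and "continuous_on {T1..T2} m" and "continuous_on {T1..T2} n"
    and "\<forall>t\<in>{T1..T2}. p t > 0" and "\<forall>t\<in>{T1..T2}. q t \<ge> 0"
    and "\<exists>t\<in>{T1..T2}. m t \<noteq> 0" and "\<exists>t\<in>{T1..T2}. n t \<noteq> 0"
    and "k \<ge> 2"
  shows
    "(C_gt_pp T1 T2 p q m n k \<noteq> {} \<longrightarrow>
       (\<exists>\<nu> \<mu>. \<exists>f :: real \<Rightarrow> real.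
          \<nu> \<ge> lambda1 T1 T2 p q m \<and> \<mu> \<ge> lambda1 T1 T2 p q n \<and>
          strict_antimono_on {\<nu><..} f \<and> f C1_differentiable_on {\<nu><..} \<and>
          f ` {\<nu><..} = {\<mu><..} \<and> (\<forall>x\<in>{\<nu><..}. deriv f x < 0) \<and>
          C_gt_pp T1 T2 p q m n k = {(x, f x) | x. x \<in> {\<nu><..}}))
     \<and>
     (C_lt_pp T1 T2 p q m n k \<noteq> {} \<longrightarrow>
       (\<exists>\<nu> \<mu>. \<exists>f :: real \<Rightarrow> real.
          \<nu> \<ge> lambda1 T1 T2 p q m \<and> \<mu> \<ge> lambda1 T1 T2 p q n \<and>
          strict_antimono_on {\<nu><..} f \<and> f C1_differentiable_on {\<nu><..} \<and>
          f ` {\<nu><..} = {\<mu><..} \<and> (\<forall>x\<in>{\<nu><..}. deriv f x < 0) \<and>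
          C_lt_pp T1 T2 p q m n k = {(x, f x) | x. x \<in> {\<nu><..}}))"
proof -
  interpret R: fucik_problem T1 T2 p q m n
    by unfold_locales (use assms in auto)
  interpret S: fucik_problem T1 T2 p q n m
    by unfold_locales (use assms in auto)
  have k: "1 \<le> k" "2 * pi \<le> real k * pi"
    using \<open>k \<ge> 2\<close> by (auto intro: mult_right_mono)
  have "C_gt_pp T1 T2 p q m n k = {(a, b). 0 < a \<and> 0 < b \<and> R.angle (a, b) T2 = real k * pi}"
    using R.C_gt_iff_angle[OF k(1)] by (auto simp: C_gt_pp_def)
  note gt = level_curve[where \<Theta> = "\<lambda>P. R.angle P T2" and A = R.sens_a and B = R.sens_b
      and c = "real k * pi" and \<alpha> = "lambda1 T1 T2 p q m" and \<beta> = "lambda1 T1 T2 p q n",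
      OF R.angle_T2_difference R.continuous_on_sens_a R.continuous_on_sens_b _ _ this]
  \<comment> \<open>\<open>S\<close> has the weights exchanged, so its angle takes the parameters in the order \<open>(b, a)\<close>.\<close>
  define flip :: "(real \<times> real) \<times> (real \<times> real) \<Rightarrow> (real \<times> real) \<times> (real \<times> real)"
    where "flip z = (prod.swap (fst z), prod.swap (snd z))" for z
  have flip: "continuous_on UNIV flip"
    unfolding flip_def prod.swap_def by (intro continuous_intros)
  have "C_lt_pp T1 T2 p q m n k =
      {(a, b). 0 < a \<and> 0 < b \<and> S.angle (prod.swap (a, b)) T2 = real k * pi}"
    using S.C_lt_iff_angle[OF k(1)] by (auto simp: C_lt_pp_def)
  note lt = level_curve[where \<Theta> = "\<lambda>P. S.angle (prod.swap P) T2"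
      and A = "\<lambda>z. S.sens_b (flip z)" and B = "\<lambda>z. S.sens_a (flip z)"
      and c = "real k * pi" and \<alpha> = "lambda1 T1 T2 p q m" and \<beta> = "lambda1 T1 T2 p q n",
      OF _ continuous_on_compose2[OF S.continuous_on_sens_b flip]
        continuous_on_compose2[OF S.continuous_on_sens_a flip] _ _ this]
  show ?thesis
  proof (intro conjI impI)
    assume ne: "C_gt_pp T1 T2 p q m n k \<noteq> {}"
    show "\<exists>\<nu> \<mu>. \<exists>f :: real \<Rightarrow> real.
          \<nu> \<ge> lambda1 T1 T2 p q m \<and> \<mu> \<ge> lambda1 T1 T2 p q n \<and>
          strict_antimono_on {\<nu><..} f \<and> f C1_differentiable_on {\<nu><..} \<and>
          f ` {\<nu><..} = {\<mu><..} \<and> (\<forall>x\<in>{\<nu><..}. deriv f x < 0) \<and>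
          C_gt_pp T1 T2 p q m n k = {(x, f x) | x. x \<in> {\<nu><..}}"
    proof (rule gt[OF _ _ ne])
      show "0 < R.sens_a ((a, b), (a, b)) \<and> 0 < R.sens_b ((a, b), (a, b))"
        if "0 < a" "0 < b" "R.angle (a, b) T2 = real k * pi" for a b
        using R.sens_diag_pos[OF that(1,2) \<open>k \<ge> 2\<close> that(3)] by blast
      show "0 < lambda1 T1 T2 p q m \<and> lambda1 T1 T2 p q m \<le> a \<and>
          0 < lambda1 T1 T2 p q n \<and> lambda1 T1 T2 p q n \<le> b"
        if "0 < a" "0 < b" "real k * pi \<le> R.angle (a, b) T2" for a b
        using R.lambda1_thresholds[OF that(1,2) order_trans[OF k(2) that(3)]] by blast
    qed
  next
    assume ne: "C_lt_pp T1 T2 p q m n k \<noteq> {}"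
    show "\<exists>\<nu> \<mu>. \<exists>f :: real \<Rightarrow> real.
          \<nu> \<ge> lambda1 T1 T2 p q m \<and> \<mu> \<ge> lambda1 T1 T2 p q n \<and>
          strict_antimono_on {\<nu><..} f \<and> f C1_differentiable_on {\<nu><..} \<and>
          f ` {\<nu><..} = {\<mu><..} \<and> (\<forall>x\<in>{\<nu><..}. deriv f x < 0) \<and>
          C_lt_pp T1 T2 p q m n k = {(x, f x) | x. x \<in> {\<nu><..}}"
    proof (rule lt[OF _ _ _ _ _ ne])
      show "S.angle (prod.swap P) T2 - S.angle (prod.swap Q) T2 =
          (fst P - fst Q) * S.sens_b (flip (P, Q)) + (snd P - snd Q) * S.sens_a (flip (P, Q))"
        for P Q
        using S.angle_T2_difference[of "prod.swap P" "prod.swap Q"] by (simp add: flip_def)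
      show "0 < S.sens_b (flip ((a, b), (a, b))) \<and> 0 < S.sens_a (flip ((a, b), (a, b)))"
        if "0 < a" "0 < b" "S.angle (prod.swap (a, b)) T2 = real k * pi" for a b
        using S.sens_diag_pos[OF that(2,1) \<open>k \<ge> 2\<close>] that(3) by (simp add: flip_def)
      show "0 < lambda1 T1 T2 p q m \<and> lambda1 T1 T2 p q m \<le> a \<and>
          0 < lambda1 T1 T2 p q n \<and> lambda1 T1 T2 p q n \<le> b"
        if "0 < a" "0 < b" "real k * pi \<le> S.angle (prod.swap (a, b)) T2" for a b
        using S.lambda1_thresholds[OF that(2,1)] order_trans[OF k(2) that(3)] by simp
    qed auto
  qed
qed

end
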